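(* Let $m,n\ge1$ be integers, let $r\in\mathbb{Z}/n\mathbb{Z}$, let $\lambda$ be a partition with at most $m$ parts, and let $k$ be a positive integer. Then $$p_k(\mathbf{x}_1,\ldots,\mathbf{x}_m)\,s_\lambda^{(r)}(\mathbf{x}_1,\ldots,\mathbf{x}_m)=\sum_{\mu}(-1)^{\mathrm{ht}(\mu/\lambda)}s_\mu^{(r)}(\mathbf{x}_1,\ldots,\mathbf{x}_m),$$ where the sum is over all partitions $\mu$ with at most $m$ parts such that $\lambda\subset\mu$ and $\mu/\lambda$ is a ribbon of size $kn$.
   Context: Fix integers $m,n\ge 1$. For $i\in\{1,\dots,m\}$ and $j\in\mathbb{Z}/n\mathbb{Z}$ let $x_i^{(j)}$ be an indeterminate (over $\mathbb{Q}$). All superscripts in parentheses are read modulo $n$. Write $\mathbf{x}_i=(x_i^{(1)},\dots,x_i^{(n)})$. **Loop power sums.** Let $\pi_i=x_i^{(1)}x_i^{(2)}\cdots x_i^{(n)}$ and, for $k\ge1$, $p_k(\mathbf{x}_1,\ldots,\mathbf{x}_m)=\sum_{i=1}^m\pi_i^k$. **Loop Schur functions.** Boxes of a Young diagram are indexed by (row, column) $=(i,j)$ with $i,j\ge1$. A semistandard tableau $T$ of shape $\lambda$ is a filling of the Young diagram of $\lambda$ with positive integers that is weakly increasing along rows and strictly increasing down columns. For $r\in\mathbb{Z}/n\mathbb{Z}$ define $$s_\lambda^{(r)}(\mathbf{x}_1,\dots,\mathbf{x}_m)=\sum_T\ \prod_{(i,j)\in\lambda} x_{T(i,j)}^{(r+i-j)},$$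 the sum being over semistandard tableaux $T$ of shape $\lambda$ with entries in $\{1,\dots,m\}$; $s_\emptyset^{(r)}=1$. **Ribbons.** For partitions $\lambda\subset\mu$ (containment of Young diagrams), $\mu/\lambda$ is the skew diagram obtained by removing the boxes of $\lambda$ from the diagram of $\mu$. A ribbon is a connected skew diagram containing no $2\times2$ square of boxes; here connectedness is via boxes sharing an edge (two boxes sharing only a vertex are not considered connected). The size of a ribbon is its number of boxes, and its height $\mathrm{ht}$ is one less than the number of rows it contains (i.e. in which it has boxes). *)

theory Defs
  imports Complex_Main "HOL-Library.Poly_Mapping" "HOL-Library.FuncSet"
begin

text \<open>
  Polynomials over the rationals: a monomial is a finitely supported exponent function, and the
  variable \<open>(i, j)\<close> stands for the indeterminate with subscript \<open>i\<close> and superscript \<open>j\<close>.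
  A superscript in \<open>\<int>/n\<int>\<close> is given by any integer representing it; \<open>loop_var\<close> reduces it
  to its representative in \<open>{0..<n}\<close>.
\<close>

type_synonym loop_poly = "((nat \<times> int) \<Rightarrow>\<^sub>0 nat) \<Rightarrow>\<^sub>0 rat"

definition loop_var :: "nat \<Rightarrow> nat \<Rightarrow> int \<Rightarrow> loop_poly" where
  "loop_var n i j = Poly_Mapping.single (Poly_Mapping.single (i, j mod int n) 1) 1"

definition loop_pi :: "nat \<Rightarrow> nat \<Rightarrow> loop_poly" where
  "loop_pi n i = (\<Prod>j = 1..n. loop_var n i (int j))"

definition loop_power_sum :: "nat \<Rightarrow> nat \<Rightarrow> nat \<Rightarrow> loop_poly" where
  "loop_power_sum n m k = (\<Sum>i = 1..m. loop_pi n i ^ k)"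

text \<open>
  A partition is the list of its nonzero parts in weakly decreasing order, so its number of parts
  is the length of the list. Boxes are pairs (row, column), both counted from 1.
\<close>

definition is_partition :: "nat list \<Rightarrow> bool" where
  "is_partition lam \<longleftrightarrow> sorted_wrt (\<ge>) lam \<and> (\<forall>a \<in> set lam. a > 0)"

definition young_diagram :: "nat list \<Rightarrow> (nat \<times> nat) set" where
  "young_diagram lam = {(i, j). 1 \<le> i \<and> i \<le> length lam \<and> 1 \<le> j \<and> j \<le> lam ! (i - 1)}"

definition semistandard :: "nat list \<Rightarrow> (nat \<times> nat \<Rightarrow> nat) \<Rightarrow> bool" where
  "semistandard lam T \<longleftrightarrow>
     (\<forall>i j j'. (i, j) \<in> young_diagram lam \<and> (i, j') \<in> young_diagram lam \<and> j \<le> j'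
        \<longrightarrow> T (i, j) \<le> T (i, j')) \<and>
     (\<forall>i i' j. (i, j) \<in> young_diagram lam \<and> (i', j) \<in> young_diagram lam \<and> i < i'
        \<longrightarrow> T (i, j) < T (i', j))"

definition ssyt :: "nat \<Rightarrow> nat list \<Rightarrow> (nat \<times> nat \<Rightarrow> nat) set" where
  "ssyt m lam = {T \<in> young_diagram lam \<rightarrow>\<^sub>E {1..m}. semistandard lam T}"

definition loop_schur :: "nat \<Rightarrow> nat \<Rightarrow> int \<Rightarrow> nat list \<Rightarrow> loop_poly" where
  "loop_schur n m r lam =
     (\<Sum>T \<in> ssyt m lam. \<Prod>(i, j) \<in> young_diagram lam. loop_var n (T (i, j)) (r + int i - int j))"

definition skew_diagram :: "nat list \<Rightarrow> nat list \<Rightarrow> (nat \<times> nat) set" where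
  "skew_diagram mu lam = young_diagram mu - young_diagram lam"

definition box_adjacent :: "nat \<times> nat \<Rightarrow> nat \<times> nat \<Rightarrow> bool" where
  "box_adjacent b c \<longleftrightarrow>
     (fst b = fst c \<and> (snd c = snd b + 1 \<or> snd b = snd c + 1)) \<or>
     (snd b = snd c \<and> (fst c = fst b + 1 \<or> fst b = fst c + 1))"

definition box_connected :: "(nat \<times> nat) set \<Rightarrow> bool" where
  "box_connected S \<longleftrightarrow>
     (\<forall>b \<in> S. \<forall>c \<in> S. (b, c) \<in> {(p, q). p \<in> S \<and> q \<in> S \<and> box_adjacent p q}\<^sup>*)"

definition has_two_by_two :: "(nat \<times> nat) set \<Rightarrow> bool" where
  "has_two_by_two S \<longleftrightarrow> (\<exists>i j. {(i, j), (i, j + 1), (i + 1, j), (i + 1, j + 1)} \<subseteq> S)"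

text \<open>
  Only applied to skew diagrams. The empty set satisfies this, but a ribbon of positive size is
  nonempty.
\<close>

definition is_ribbon :: "(nat \<times> nat) set \<Rightarrow> bool" where
  "is_ribbon S \<longleftrightarrow> box_connected S \<and> \<not> has_two_by_two S"

definition ribbon_height :: "(nat \<times> nat) set \<Rightarrow> nat" where
  "ribbon_height S = card (fst ` S) - 1"

definition ribbon_extensions :: "nat \<Rightarrow> nat list \<Rightarrow> nat \<Rightarrow> nat list set" where
  "ribbon_extensions m lam N =
     {mu. is_partition mu \<and> length mu \<le> m \<and> young_diagram lam \<subseteq> young_diagram mu \<and>
          is_ribbon (skew_diagram mu lam) \<and> card (skew_diagram mu lam) = N}"

lemma finite_young_diagram: "finite (young_diagram lam)"
proof -
  have "young_diagram lam \<subseteq> {..length lam} \<times> {..Max (set lam)}"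
    by (force simp: young_diagram_def intro: order_trans[OF _ Max_ge])
  then show ?thesis by (rule finite_subset) simp
qed

lemma finite_ssyt: "finite (ssyt m lam)"
  unfolding ssyt_def by (simp add: finite_PiE finite_young_diagram)

lemma finite_ribbon_extensions: "finite (ribbon_extensions m lam N)"
proof -
  let ?B = "card (young_diagram lam) + N"
  have "set mu \<subseteq> {..?B} \<and> length mu \<le> m" if mu: "mu \<in> ribbon_extensions m lam N" for mu
  proof -
    have sub: "young_diagram lam \<subseteq> young_diagram mu" and
      N: "card (young_diagram mu - young_diagram lam) = N" and len: "length mu \<le> m"
      using mu by (auto simp: ribbon_extensions_def skew_diagram_def)
    have B: "card (young_diagram mu) = ?B"
      using card_Diff_subset[OF finite_young_diagram sub] N
        card_mono[OF finite_young_diagram sub] by simp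
    have "a \<le> ?B" if "a \<in> set mu" for a
    proof -
      obtain i where i: "i < length mu" "mu ! i = a"
        using \<open>a \<in> set mu\<close> by (auto simp: in_set_conv_nth)
      have "{Suc i} \<times> {1..a} \<subseteq> young_diagram mu"
        using i by (auto simp: young_diagram_def)
      from card_mono[OF finite_young_diagram this] show ?thesis using B by simp
    qed
    with len show ?thesis by auto
  qed
  then have "ribbon_extensions m lam N \<subseteq> {mu. set mu \<subseteq> {..?B} \<and> length mu \<le> m}" by blast
  then show ?thesis by (rule finite_subset) (simp add: finite_lists_length_le)
qed

end

theory Submission
  imports Defs "Jordan_Normal_Form.Determinant"
begin

text \<open>
  Encode a shape \<open>\<lambda>\<close> with at most \<open>m\<close> rows by its beads \<open>\<lambda>\<^sub>i + m - i\<close>. The step of a bead to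
  position \<open>p\<close> adds a box of content \<open>p - m\<close>, hence of colour \<open>r + m - p\<close>. Let \<open>X\<^sub>i\<close> be the shift of
  sequences on the natural numbers whose weight for the step to \<open>p\<close> is the variable
  \<open>x\<^sub>i\<close> of that colour. Applying \<open>(1 - X\<^sub>m)\<^sup>-\<^sup>1 \<dots> (1 - X\<^sub>1)\<^sup>-\<^sup>1\<close> to the first \<open>m\<close> unit sequences
  gives sequences \<open>F\<^sub>1, \<dots>, F\<^sub>m\<close>, and the loop Schur function is the determinant of their values at
  the beads of \<open>\<lambda>\<close>.

  Weights are periodic with period \<open>n\<close>, so the span of the \<open>F\<^sub>j\<close> is stable under the shift
  \<open>c \<mapsto> c + kn\<close>, which acts on it with trace \<open>p\<^sub>k\<close>. Therefore \<open>p\<^sub>k\<close> times the determinant is the sum of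
  the determinants in which one bead is moved up by \<open>kn\<close>. If the new position is occupied, the
  determinant vanishes; otherwise sorting the beads yields \<open>\<lambda>\<close> with a ribbon of size \<open>kn\<close> added,
  and the bead overtakes as many others as the height of the ribbon.
\<close>

section \<open>Determinants with rows indexed by positions\<close>

text \<open>The sequences \<open>f j\<close> give the columns and \<open>c\<close> picks the
  positions sampled by the rows. Positions may repeat or be out of order: repetition gives zero,
  reordering a sign.\<close>

definition row_det :: "nat \<Rightarrow> (nat \<Rightarrow> 'b \<Rightarrow> 'a::comm_ring_1) \<Rightarrow> (nat \<Rightarrow> 'b) \<Rightarrow> 'a" where
  "row_det m f c = det (mat m m (\<lambda>(i, j). f j (c i)))"

lemma row_det_cong: "(\<And>i. i < m \<Longrightarrow> c i = d i) \<Longrightarrow> row_det m f c = row_det m f d"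
  unfolding row_det_def by (intro arg_cong[where f = det] eq_matI) auto

lemma row_det_eq_0:
  assumes "i < m" "j < m" "i \<noteq> j" "c i = c j"
  shows "row_det m f c = 0"
  unfolding row_det_def
  by (rule det_identical_rows[of _ m i j]) (use assms in \<open>auto intro!: eq_vecI\<close>)

lemma row_det_swap:
  assumes "i < m" "j < m" "i \<noteq> j"
  shows "row_det m f (c \<circ> Transposition.transpose i j) = - row_det m f c"
proof -
  let ?A = "mat m m (\<lambda>(i, j). f j (c i))"
  have "row_det m f (c \<circ> Transposition.transpose i j) =
      det (mat m m (\<lambda>(k, l). ?A $$ (Transposition.transpose i j k, l)))"
    unfolding row_det_def using assms
    by (intro arg_cong[where f = det] eq_matI) (auto simp: Transposition.transpose_def)
  also have "\<dots> = signof (Transposition.transpose i j) * det ?A"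
    using assms by (intro det_permute_rows) (auto intro!: permutes_swap_id)
  finally show ?thesis
    using assms by (simp add: row_det_def sign_swap_id)
qed

text \<open>Moving entry \<open>i\<close> to place \<open>h\<close> and pushing those in between one
  place on is a cycle of \<open>i - h\<close> adjacent transpositions, peeled off one at a
  time.\<close>

lemma row_det_move_row:
  assumes "h \<le> i" "i < m"
  shows "row_det m f (\<lambda>l. if l = h then c i else if h < l \<and> l \<le> i then c (l - 1) else c l)
    = (- 1) ^ (i - h) * row_det m f c"
  using assms
proof (induction i arbitrary: c rule: dec_induct)
  case base
  have "(\<lambda>l. if l = h then c h else if h < l \<and> l \<le> h then c (l - 1) else c l) = c"
    by auto
  then show ?case by simp
next
  case (step i)
  let ?d = "c \<circ> Transposition.transpose i (Suc i)"
  have "row_det m f (\<lambda>l. if l = h then c (Suc i) else if h < l \<and> l \<le> Suc i then c (l - 1) else c l) =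
     row_det m f (\<lambda>l. if l = h then ?d i else if h < l \<and> l \<le> i then ?d (l - 1) else ?d l)"
    using step.hyps by (intro row_det_cong) (auto simp: Transposition.transpose_def)
  also have "\<dots> = (- 1) ^ (i - h) * row_det m f ?d"
    using step.prems by (intro step.IH) simp
  also have "\<dots> = (- 1) ^ (Suc i - h) * row_det m f c"
    using step row_det_swap[of i m "Suc i" f c] by (simp add: Suc_diff_le)
  finally show ?case .
qed

text \<open>Multilinearity in the rows, obtained by multiplying out the products in the Leibniz
  formula.\<close>

lemma det_sum_rows:
  assumes "\<And>i. i < m \<Longrightarrow> finite (B i)"
  shows "det (mat m m (\<lambda>(i, j). \<Sum>b\<in>B i. w i b * f j b)) =
    (\<Sum>b\<in>PiE {..<m} B. (\<Prod>i<m. w i (b i)) * row_det m f b)"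
proof -
  let ?P = "{p. p permutes {0..<m}}"
  have less: "p i < m" if "p \<in> ?P" "i < m" for p i
    using that permutes_in_image[of p "{0..<m}" i] by simp
  have "det (mat m m (\<lambda>(i, j). \<Sum>b\<in>B i. w i b * f j b)) =
      (\<Sum>p\<in>?P. signof p * (\<Prod>i<m. \<Sum>b\<in>B i. w i b * f (p i) b))"
    by (subst det_def'[of _ m]) (auto simp: less lessThan_atLeast0 intro!: sum.cong prod.cong)
  also have "\<dots> = (\<Sum>p\<in>?P. \<Sum>b\<in>PiE {..<m} B. signof p * (\<Prod>i<m. w i (b i) * f (p i) (b i)))"
    using assms by (intro sum.cong refl) (subst prod_sum_PiE, auto simp: sum_distrib_left)
  also have "\<dots> = (\<Sum>b\<in>PiE {..<m} B. \<Sum>p\<in>?P. signof p * (\<Prod>i<m. w i (b i) * f (p i) (b i)))"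
    by (rule sum.swap)
  also have "\<dots> = (\<Sum>b\<in>PiE {..<m} B. (\<Prod>i<m. w i (b i)) * row_det m f b)"
    unfolding row_det_def
    by (intro sum.cong refl, subst det_def'[of _ m])
       (auto simp: less prod.distrib sum_distrib_left lessThan_atLeast0 ac_simps intro!: sum.cong prod.cong)
  finally show ?thesis .
qed

text \<open>
  The derivation induced on the top exterior power by an endomorphism acts by its trace.
\<close>

lemma sum_row_det_eq_trace:
  assumes T: "\<And>i j. i < m \<Longrightarrow> j < m \<Longrightarrow> f j (g (c i)) = (\<Sum>l<m. T j l * f l (c i))"
  shows "(\<Sum>i<m. row_det m f (c(i := g (c i)))) = (\<Sum>j<m. T j j) * row_det m f c"
proof -
  define A where "A = mat m m (\<lambda>(i, j). f j (c i))"
  have A: "A \<in> carrier_mat m m" by (simp add: A_def)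
  have row: "row_det m f (c(i := g (c i))) = (\<Sum>j<m. \<Sum>l<m. T j l * (A $$ (i, l) * cofactor A i j))"
    if i: "i < m" for i
  proof -
    let ?B = "mat m m (\<lambda>(k, j). f j ((c(i := g (c i))) k))"
    \<comment> \<open>Cofactors along row \<open>i\<close> do not involve row \<open>i\<close>, so
      expanding along the replaced row uses those of \<open>A\<close>.\<close>
    have "cofactor ?B i j = cofactor A i j" if "j < m" for j
    proof -
      have "mat_delete ?B i j = mat_delete A i j"
        using i that unfolding mat_delete_def A_def by (intro eq_matI) auto
      then show ?thesis by (simp add: cofactor_def)
    qed
    then have "row_det m f (c(i := g (c i))) = (\<Sum>j<m. f j (g (c i)) * cofactor A i j)"
      unfolding row_det_def using i by (subst laplace_expansion_row[of ?B m i]) auto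
    also have "\<dots> = (\<Sum>j<m. \<Sum>l<m. T j l * (A $$ (i, l) * cofactor A i j))"
      using i by (intro sum.cong refl) (simp add: T sum_distrib_right A_def ac_simps)
    finally show ?thesis .
  qed
  \<comment> \<open>Summing over the moved row pairs column \<open>l\<close> of \<open>A\<close>
    with the cofactors of column \<open>j\<close>; only the diagonal of \<open>T\<close>
    survives.\<close>
  have adj: "(\<Sum>i<m. A $$ (i, l) * cofactor A i j) = (if j = l then det A else 0)"
    if "j < m" "l < m" for j l
  proof -
    have "(adj_mat A * A) $$ (j, l) = (\<Sum>i<m. A $$ (i, l) * cofactor A i j)"
      using A that adj_mat(1)[OF A]
      by (simp add: scalar_prod_def adj_mat_def lessThan_atLeast0 mult.commute)
    moreover have "(adj_mat A * A) $$ (j, l) = (if j = l then det A else 0)"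
      unfolding adj_mat(3)[OF A] using that by simp
    ultimately show ?thesis by simp
  qed
  have "(\<Sum>i<m. row_det m f (c(i := g (c i)))) =
      (\<Sum>i<m. \<Sum>j<m. \<Sum>l<m. T j l * (A $$ (i, l) * cofactor A i j))"
    by (simp add: row)
  also have "\<dots> = (\<Sum>j<m. \<Sum>i<m. \<Sum>l<m. T j l * (A $$ (i, l) * cofactor A i j))"
    by (rule sum.swap)
  also have "\<dots> = (\<Sum>j<m. \<Sum>l<m. \<Sum>i<m. T j l * (A $$ (i, l) * cofactor A i j))"
    by (intro sum.cong refl sum.swap)
  also have "\<dots> = (\<Sum>j<m. \<Sum>l<m. if j = l then T j l * det A else 0)"
    by (intro sum.cong refl) (simp add: adj flip: sum_distrib_left)
  also have "\<dots> = (\<Sum>j<m. T j j) * det A"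
    by (simp add: sum_distrib_right)
  finally show ?thesis by (simp add: row_det_def A_def)
qed

section \<open>Transfer operators\<close>

text \<open>
  \<open>transfer x\<close> is the inverse of \<open>1 - X\<close>, where \<open>X\<close> is the shift with weight \<open>x c\<close> on the step
  from \<open>c - 1\<close> to \<open>c\<close>.
\<close>

primrec transfer :: "(nat \<Rightarrow> 'a::comm_ring_1) \<Rightarrow> (nat \<Rightarrow> 'a) \<Rightarrow> nat \<Rightarrow> 'a" where
  "transfer x g 0 = g 0"
| "transfer x g (Suc c) = x (Suc c) * transfer x g c + g (Suc c)"

lemma transfer_sum:
  "transfer x (\<lambda>c. \<Sum>l\<in>A. t l * g l c) c = (\<Sum>l\<in>A. t l * transfer x (g l) c)"
  by (induction c) (simp_all add: sum_distrib_left sum.distrib algebra_simps)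

lemma greaterThanAtMost_Suc: "a \<le> b \<Longrightarrow> {a<..Suc b} = insert (Suc b) {a<..b}"
  by auto

text \<open>The recursion is unrolled down to \<open>c0\<close>. With \<open>c0\<close> the next
  bead, subtracting a multiple of the value at \<open>c0\<close> leaves only positions above
  \<open>c0\<close>: this is the row operation of \<open>row_det_basis_seq_Suc\<close>.\<close>

lemma transfer_split:
  assumes "c0 \<le> c"
  shows "transfer x g c = (\<Prod>p\<in>{c0<..c}. x p) * transfer x g c0
    + (\<Sum>b\<in>{c0<..c}. (\<Prod>p\<in>{b<..c}. x p) * g b)"
  using assms
proof (induction c rule: dec_induct)
  case (step c)
  have "(\<Sum>b\<in>{c0<..c}. (\<Prod>p\<in>{b<..Suc c}. x p) * g b) =
      x (Suc c) * (\<Sum>b\<in>{c0<..c}. (\<Prod>p\<in>{b<..c}. x p) * g b)"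
    by (simp add: sum_distrib_left greaterThanAtMost_Suc ac_simps)
  then show ?case
    using step by (simp add: greaterThanAtMost_Suc algebra_simps)
qed simp

lemma transfer_eq_sum: "transfer x g c = (\<Sum>b\<le>c. (\<Prod>p\<in>{b<..c}. x p) * g b)"
proof -
  have "{..c} = insert 0 {0<..c}" by auto
  then show ?thesis using transfer_split[of 0 c x g] by simp
qed

text \<open>By periodicity both sequences obey the same recursion, but the shifted one starts from
  \<open>transfer x g K\<close> instead of \<open>g K\<close>. The discrepancy propagates along the
  homogeneous solution, the product of the weights.\<close>

lemma transfer_shift:
  assumes "\<And>p. x (p + K) = x p"
  shows "transfer x g (c + K) = transfer x (\<lambda>c. g (c + K)) c
    + (transfer x g K - g K) * (\<Prod>p\<in>{0<..c}. x p)"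
proof (induction c)
  case (Suc c)
  have "transfer x g (Suc c + K) = x (Suc c) * transfer x g (c + K) + g (Suc c + K)"
    using assms[of "Suc c"] by simp
  then show ?case
    unfolding Suc by (simp add: greaterThanAtMost_Suc algebra_simps)
qed simp

section \<open>Sequences spanned by iterated transfers\<close>

definition unit_seq :: "nat \<Rightarrow> nat \<Rightarrow> 'a::comm_ring_1" where
  "unit_seq i c = (if c = i then 1 else 0)"

lemma transfer_unit_seq_0: "transfer x (unit_seq 0) c = (\<Prod>p\<in>{0<..c}. x p)"
  by (induction c) (simp_all add: greaterThanAtMost_Suc unit_seq_def)

text \<open>The argument of \<open>transfer\<close> is 1 - X applied to the unit sequence at
  \<open>i\<close>.\<close>

lemma transfer_unit_seq_diff:
  "transfer x (\<lambda>c. unit_seq i c - x (Suc i) * unit_seq (Suc i) c) c = unit_seq i c"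
  by (induction c) (auto simp: unit_seq_def)

text \<open>\<open>a\<close> counts the variables applied so far. Sequence \<open>j\<close> starts
  as the unit sequence at \<open>m - Suc j\<close>, the bead of row \<open>j\<close> of the empty
  shape, so that without variables the empty shape gives the identity matrix.\<close>

primrec basis_seq :: "(nat \<Rightarrow> nat \<Rightarrow> 'a::comm_ring_1) \<Rightarrow> nat \<Rightarrow> nat \<Rightarrow> nat \<Rightarrow> nat \<Rightarrow> 'a" where
  "basis_seq y m 0 j = unit_seq (m - Suc j)"
| "basis_seq y m (Suc a) j = transfer (y (Suc a)) (basis_seq y m a j)"

text \<open>By \<open>transfer_unit_seq_diff\<close>, position \<open>i\<close> is obtained from
  positions \<open>i\<close> and \<open>Suc i\<close> one level earlier. Each variable thus costs
  the top position, whence the bound; position 0 remains available as long as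
  \<open>a < m\<close>.\<close>

lemma unit_seq_in_span_basis_seq:
  assumes "a + i < m"
  shows "\<exists>\<alpha>. \<forall>c. unit_seq i c = (\<Sum>l<m. \<alpha> l * basis_seq y m a l c)"
  using assms
proof (induction a arbitrary: i)
  case 0
  have "unit_seq i c = (\<Sum>l<m. (if l = m - Suc i then 1 else 0) * basis_seq y m 0 l c)" for c
    using 0 by (simp add: if_distrib[of "\<lambda>x. x * _"] Suc_diff_Suc cong: if_cong)
  then show ?case by (intro exI allI)
next
  case (Suc a)
  obtain \<alpha> where \<alpha>: "\<And>c. unit_seq i c = (\<Sum>l<m. \<alpha> l * basis_seq y m a l c)"
    using Suc.IH[of i] Suc.prems by auto
  obtain \<beta> where \<beta>: "\<And>c. unit_seq (Suc i) c = (\<Sum>l<m. \<beta> l * basis_seq y m a l c)"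
    using Suc.IH[of "Suc i"] Suc.prems by auto
  let ?x = "y (Suc a)"
  have "unit_seq i c = (\<Sum>l<m. (\<alpha> l - ?x (Suc i) * \<beta> l) * basis_seq y m (Suc a) l c)" for c
  proof -
    have "unit_seq i c = transfer ?x (\<lambda>c. unit_seq i c - ?x (Suc i) * unit_seq (Suc i) c) c"
      by (simp add: transfer_unit_seq_diff)
    also have "(\<lambda>c. unit_seq i c - ?x (Suc i) * unit_seq (Suc i) c) =
        (\<lambda>c. \<Sum>l<m. (\<alpha> l - ?x (Suc i) * \<beta> l) * basis_seq y m a l c)"
      unfolding \<alpha> \<beta> by (simp add: sum_distrib_left sum_subtractf algebra_simps)
    finally show ?thesis by (simp add: transfer_sum)
  qed
  then show ?case by (intro exI allI)
qed

text \<open>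
  Each further variable changes the matrix of the shift by one of rank one, whose trace is the
  product of that variable's weights over the period.
\<close>

lemma shift_basis_seq_trace:
  assumes per: "\<And>i p. y i (p + K) = y i p" and K: "K \<ge> 1" and "a \<le> m"
  shows "\<exists>T. (\<forall>j<m. \<forall>c. basis_seq y m a j (c + K) = (\<Sum>l<m. T j l * basis_seq y m a l c)) \<and>
    (\<Sum>j<m. T j j) = (\<Sum>i = 1..a. \<Prod>p\<in>{0<..K}. y i p)"
  using \<open>a \<le> m\<close>
proof (induction a)
  case 0
  \<comment> \<open>The shift carries the unit sequence at \<open>m - Suc j\<close> to that at
    \<open>m - Suc (j + K)\<close>, or to zero if \<open>j + K >= m\<close>. As \<open>K\<close> is
    positive, the diagonal vanishes.\<close>
  define T :: "nat \<Rightarrow> nat \<Rightarrow> 'a" where "T = (\<lambda>j l. if l = j + K then 1 else 0)"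
  have "basis_seq y m 0 j (c + K) = (\<Sum>l<m. T j l * basis_seq y m 0 l c)" if "j < m" for j c
    using that by (auto simp: T_def unit_seq_def if_distrib[of "\<lambda>x. x * _"] cong: if_cong)
  moreover have "(\<Sum>j<m. T j j) = 0"
    using K by (intro sum.neutral) (simp add: T_def)
  ultimately show ?case by auto
next
  case (Suc a)
  let ?x = "y (Suc a)"
  let ?f = "basis_seq y m a"
  obtain T where T: "\<And>j c. j < m \<Longrightarrow> ?f j (c + K) = (\<Sum>l<m. T j l * ?f l c)"
    and tr: "(\<Sum>j<m. T j j) = (\<Sum>i = 1..a. \<Prod>p\<in>{0<..K}. y i p)"
    using Suc by auto
  obtain \<alpha> where \<alpha>: "\<And>c. unit_seq 0 c = (\<Sum>l<m. \<alpha> l * ?f l c)"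
    using unit_seq_in_span_basis_seq[of a 0 m y] Suc.prems by auto
  \<comment> \<open>The rank-one correction: \<open>z\<close> holds the starting discrepancies of
    \<open>transfer_shift\<close>, and \<open>\<alpha>\<close> the coordinates of the homogeneous
    solution in the new sequences.\<close>
  define z where "z j = transfer ?x (?f j) K - ?f j K" for j
  have unit: "(\<Prod>p\<in>{0<..c}. ?x p) = (\<Sum>l<m. \<alpha> l * basis_seq y m (Suc a) l c)" for c
  proof -
    have "(unit_seq 0 :: nat \<Rightarrow> 'a) = (\<lambda>c. \<Sum>l<m. \<alpha> l * ?f l c)"
      by (rule ext) (rule \<alpha>)
    then show ?thesis
      unfolding transfer_unit_seq_0[symmetric] by (simp add: transfer_sum)
  qed
  have "basis_seq y m (Suc a) j (c + K) = (\<Sum>l<m. (T j l + z j * \<alpha> l) * basis_seq y m (Suc a) l c)"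
    if "j < m" for j c
  proof -
    have "basis_seq y m (Suc a) j (c + K) =
        transfer ?x (\<lambda>c. ?f j (c + K)) c + z j * (\<Prod>p\<in>{0<..c}. ?x p)"
      using per by (simp add: transfer_shift z_def)
    then show ?thesis
      using that unfolding unit T[OF that]
      by (simp add: transfer_sum sum_distrib_left sum.distrib algebra_simps)
  qed
  moreover have "(\<Sum>j<m. T j j + z j * \<alpha> j) = (\<Sum>i = 1..Suc a. \<Prod>p\<in>{0<..K}. y i p)"
  proof -
    \<comment> \<open>The combination \<open>\<alpha>\<close> of the new sequences is the
      homogeneous solution, that of the old ones the unit sequence at 0. At \<open>K\<close> the
      latter is zero.\<close>
    have "(\<Sum>j<m. z j * \<alpha> j) = (\<Sum>j<m. \<alpha> j * transfer ?x (?f j) K) - (\<Sum>j<m. \<alpha> j * ?f j K)"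
      by (simp add: z_def sum_subtractf algebra_simps)
    also have "\<dots> = (\<Prod>p\<in>{0<..K}. ?x p) - unit_seq 0 K"
      by (simp add: unit \<alpha>)
    also have "\<dots> = (\<Prod>p\<in>{0<..K}. ?x p)"
      using K by (simp add: unit_seq_def)
    finally show ?thesis by (simp add: sum.distrib tr)
  qed
  ultimately show ?case
    by (intro exI[of _ "\<lambda>j l. T j l + z j * \<alpha> l"]) blast
qed

section \<open>Branching of tableaux\<close>

definition shape_boxes :: "(nat \<Rightarrow> nat) \<Rightarrow> (nat \<times> nat) set" where
  "shape_boxes f = {(i, j). 1 \<le> i \<and> 1 \<le> j \<and> j \<le> f (i - 1)}"

definition tableaux :: "nat \<Rightarrow> (nat \<times> nat) set \<Rightarrow> (nat \<times> nat \<Rightarrow> nat) set" where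
  "tableaux a D = {T \<in> D \<rightarrow>\<^sub>E {1..a}.
     (\<forall>i j j'. (i, j) \<in> D \<and> (i, j') \<in> D \<and> j \<le> j' \<longrightarrow> T (i, j) \<le> T (i, j')) \<and>
     (\<forall>i i' j. (i, j) \<in> D \<and> (i', j) \<in> D \<and> i < i' \<longrightarrow> T (i, j) < T (i', j))}"

definition tableau_sum :: "(nat \<Rightarrow> nat \<times> nat \<Rightarrow> 'a::comm_ring_1) \<Rightarrow> nat \<Rightarrow> (nat \<times> nat) set \<Rightarrow> 'a" where
  "tableau_sum x a D = (\<Sum>T\<in>tableaux a D. \<Prod>b\<in>D. x (T b) b)"

text \<open>For a weakly decreasing \<open>f\<close>, these are the \<open>g\<close> for which
  \<open>f/g\<close> is a horizontal strip, that is, no column loses two boxes.\<close>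

definition interlacing :: "(nat \<Rightarrow> nat) \<Rightarrow> (nat \<Rightarrow> nat) set" where
  "interlacing f = {g. \<forall>i. f (Suc i) \<le> g i \<and> g i \<le> f i}"

lemma mem_shape_boxes: "(i, j) \<in> shape_boxes f \<longleftrightarrow> 1 \<le> i \<and> 1 \<le> j \<and> j \<le> f (i - 1)"
  by (simp add: shape_boxes_def)

lemma mem_skew_shape_boxes:
  "(Suc l, j) \<in> shape_boxes g - shape_boxes f \<longleftrightarrow> f l < j \<and> j \<le> g l"
  by (auto simp: mem_shape_boxes)

lemma skew_shape_boxesE:
  assumes "b \<in> shape_boxes g - shape_boxes f"
  obtains l j where "b = (Suc l, j)" "f l < j" "j \<le> g l"
  using assms by (cases b; cases "fst b") (auto simp: shape_boxes_def)

lemma shape_boxes_subset_iff: "shape_boxes f \<subseteq> shape_boxes g \<longleftrightarrow> f \<le> g"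
proof
  assume sub: "shape_boxes f \<subseteq> shape_boxes g"
  have "f i \<le> g i" for i
    using subsetD[OF sub, of "(Suc i, f i)"] by (cases "f i = 0") (auto simp: shape_boxes_def)
  then show "f \<le> g" by (simp add: le_fun_def)
qed (auto simp: shape_boxes_def le_fun_def intro: order_trans)

lemma inj_shape_boxes: "inj shape_boxes"
  by (rule injI) (metis shape_boxes_subset_iff order_refl order_antisym)

lemma finite_shape_boxes:
  assumes "\<And>i. m \<le> i \<Longrightarrow> f i = 0"
  shows "finite (shape_boxes f)"
proof -
  have "shape_boxes f \<subseteq> (SIGMA i:{..m}. {..f (i - 1)})"
  proof
    fix b assume "b \<in> shape_boxes f"
    then obtain i j where b: "b = (i, j)" "1 \<le> i" "1 \<le> j" "j \<le> f (i - 1)"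
      by (cases b) (auto simp: shape_boxes_def)
    then have "i - 1 < m" using assms[of "i - 1"] by (cases "m \<le> i - 1") auto
    then show "b \<in> (SIGMA i:{..m}. {..f (i - 1)})" using b by auto
  qed
  then show ?thesis by (rule finite_subset) auto
qed

lemma finite_tableaux: "finite D \<Longrightarrow> finite (tableaux a D)"
  unfolding tableaux_def by (simp add: finite_PiE)

lemma interlacing_antimono:
  assumes "g \<in> interlacing f"
  shows "antimono g"
  using assms by (intro antimono_iff_le_Suc[THEN iffD2] allI)
    (auto simp: interlacing_def intro: order_trans)

lemma interlacing_eq_0:
  assumes "\<And>i. m \<le> i \<Longrightarrow> f i = 0" "g \<in> interlacing f" "m \<le> i"
  shows "g i = 0"
  using assms by (simp add: interlacing_def) (metis le_zero_eq)

lemma interlacing_shape_boxes_subset: "g \<in> interlacing f \<Longrightarrow> shape_boxes g \<subseteq> shape_boxes f"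
  by (simp add: shape_boxes_subset_iff interlacing_def le_fun_def)

lemma finite_interlacing:
  assumes "\<And>i. m \<le> i \<Longrightarrow> f i = 0"
  shows "finite (interlacing f)"
proof (rule finite_imageD)
  have "shape_boxes ` interlacing f \<subseteq> Pow (shape_boxes f)"
    using interlacing_shape_boxes_subset by blast
  then show "finite (shape_boxes ` interlacing f)"
    by (rule finite_subset) (simp add: finite_shape_boxes[OF assms])
  show "inj_on shape_boxes (interlacing f)"
    by (rule inj_on_subset[OF inj_shape_boxes]) simp
qed

section \<open>Removing and adding the largest entry of a tableau\<close>

lemma down_closed_eq_atLeastAtMost_card:
  assumes "finite J" "0 \<notin> J" "\<And>j j'. j' \<in> J \<Longrightarrow> 1 \<le> j \<Longrightarrow> j \<le> j' \<Longrightarrow> j \<in> J"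
  shows "J = {1..card J}"
proof (cases "J = {}")
  case False
  have "J = {1..Max J}"
  proof
    show "J \<subseteq> {1..Max J}"
      using assms(1,2) by (auto simp: Suc_le_eq intro: gr0I)
    show "{1..Max J} \<subseteq> J"
      using assms(3)[OF Max_in[OF assms(1) False]] by auto
  qed
  then show ?thesis by (metis card_atLeastAtMost diff_Suc_1)
qed simp

definition sub_shape :: "nat \<Rightarrow> (nat \<times> nat) set \<Rightarrow> (nat \<times> nat \<Rightarrow> nat) \<Rightarrow> nat \<Rightarrow> nat" where
  "sub_shape a D T i = card {j. (Suc i, j) \<in> D \<and> T (Suc i, j) \<le> a}"

text \<open>Rows increase weakly, so the entries at most \<open>a\<close> fill an initial segment of
  each row, and counting them recovers the boxes.\<close>

lemma shape_boxes_sub_shape: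
  assumes T: "T \<in> tableaux c (shape_boxes f)"
  shows "shape_boxes (sub_shape a (shape_boxes f) T) = {b \<in> shape_boxes f. T b \<le> a}"
proof -
  let ?D = "shape_boxes f"
  have row: "{j. (Suc i, j) \<in> ?D \<and> T (Suc i, j) \<le> a} = {1..sub_shape a ?D T i}" for i
    unfolding sub_shape_def
  proof (rule down_closed_eq_atLeastAtMost_card)
    show "finite {j. (Suc i, j) \<in> ?D \<and> T (Suc i, j) \<le> a}"
      by (rule finite_subset[of _ "{..f i}"]) (auto simp: shape_boxes_def)
    show "0 \<notin> {j. (Suc i, j) \<in> ?D \<and> T (Suc i, j) \<le> a}"
      by (simp add: shape_boxes_def)
    fix j j' assume *: "j' \<in> {j. (Suc i, j) \<in> ?D \<and> T (Suc i, j) \<le> a}" "1 \<le> j" "j \<le> j'"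
    then have "(Suc i, j) \<in> ?D" by (auto simp: shape_boxes_def)
    moreover from this have "T (Suc i, j) \<le> T (Suc i, j')"
      using T * by (auto simp: tableaux_def)
    ultimately show "j \<in> {j. (Suc i, j) \<in> ?D \<and> T (Suc i, j) \<le> a}"
      using * by auto
  qed
  have "(i, j) \<in> shape_boxes (sub_shape a ?D T) \<longleftrightarrow> (i, j) \<in> {b \<in> ?D. T b \<le> a}" for i j
  proof (cases i)
    case (Suc i')
    then show ?thesis using row[of i'] by (auto simp: mem_shape_boxes set_eq_iff)
  qed (simp add: shape_boxes_def)
  then show ?thesis by auto
qed

text \<open>The box above the last box of the next row has a strictly smaller entry, hence one at
  most \<open>a\<close>, so the small entries reach at least that far.\<close>

lemma sub_shape_interlacing:
  assumes f: "antimono f" and T: "T \<in> tableaux (Suc a) (shape_boxes f)"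
  shows "sub_shape a (shape_boxes f) T \<in> interlacing f"
  unfolding interlacing_def
proof (intro CollectI allI conjI)
  fix i
  let ?g = "sub_shape a (shape_boxes f) T"
  note boxes = shape_boxes_sub_shape[OF T, of a]
  have "shape_boxes ?g \<subseteq> shape_boxes f" by (auto simp: boxes)
  then show "?g i \<le> f i" by (simp add: shape_boxes_subset_iff le_fun_def)
  show "f (Suc i) \<le> ?g i"
  proof (cases "f (Suc i) = 0")
    case False
    let ?j = "f (Suc i)"
    have "(Suc i, ?j) \<in> shape_boxes f" "(Suc (Suc i), ?j) \<in> shape_boxes f"
      using False antimonoD[OF f, of i "Suc i"] by (auto simp: mem_shape_boxes)
    moreover from this have "T (Suc i, ?j) < T (Suc (Suc i), ?j)" "T (Suc (Suc i), ?j) \<le> Suc a"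
      using T by (auto simp: tableaux_def PiE_iff)
    ultimately have "(Suc i, ?j) \<in> shape_boxes ?g" by (simp add: boxes)
    then show ?thesis by (simp add: mem_shape_boxes)
  qed simp
qed

text \<open>By interlacing, a box with another one below it in its column lies in
  \<open>shape_boxes g\<close>, so a new entry \<open>Suc a\<close> never stands above another
  entry.\<close>

lemma extend_tableau:
  assumes f: "antimono f" and g: "g \<in> interlacing f" and T: "T \<in> tableaux a (shape_boxes g)"
  defines "T' \<equiv> \<lambda>b\<in>shape_boxes f. if b \<in> shape_boxes g then T b else Suc a"
  shows "T' \<in> tableaux (Suc a) (shape_boxes f)"
proof -
  have T_le: "T b \<in> {1..a}" if "b \<in> shape_boxes g" for b
    using T that by (auto simp: tableaux_def PiE_iff)
  have g_mono: "antimono g" using g by (rule interlacing_antimono)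
  have "T' (i, j) \<le> T' (i, j')"
    if "(i, j) \<in> shape_boxes f" "(i, j') \<in> shape_boxes f" "j \<le> j'" for i j j'
  proof (cases "(i, j') \<in> shape_boxes g")
    case True
    then have "(i, j) \<in> shape_boxes g" using that by (auto simp: mem_shape_boxes)
    then show ?thesis using True that T by (auto simp: T'_def tableaux_def)
  next
    case False
    then show ?thesis using that T_le[of "(i, j)"] by (auto simp: T'_def)
  qed
  moreover have "T' (i, j) < T' (i', j)"
    if ij: "(i, j) \<in> shape_boxes f" and i'j: "(i', j) \<in> shape_boxes f" and less: "i < i'" for i i' j
  proof -
    have "f (i' - 1) \<le> f i"
      using less antimonoD[OF f, of i "i' - 1"] by auto
    also have "f i \<le> g (i - 1)"
    proof -
      have "f (Suc (i - 1)) \<le> g (i - 1)" using g by (simp add: interlacing_def)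
      then show ?thesis using ij by (simp add: mem_shape_boxes)
    qed
    finally have "(i, j) \<in> shape_boxes g"
      using ij i'j by (auto simp: mem_shape_boxes)
    then show ?thesis
      using that T T_le[of "(i, j)"] by (auto simp: T'_def tableaux_def)
  qed
  moreover have "T' \<in> shape_boxes f \<rightarrow>\<^sub>E {1..Suc a}"
    using T_le by (auto simp: T'_def PiE_iff le_Suc_eq)
  ultimately show ?thesis by (auto simp: tableaux_def)
qed

lemma tableaux_restrict:
  assumes "T \<in> tableaux c D" "D' \<subseteq> D" "\<And>b. b \<in> D' \<Longrightarrow> T b \<le> a"
  shows "restrict T D' \<in> tableaux a D'"
  using assms by (auto simp: tableaux_def PiE_iff subset_iff)

text \<open>\<open>g\<close> is the shape of the boxes whose entry is not the largest one.\<close>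

lemma tableau_sum_Suc:
  assumes f: "antimono f" and f0: "\<And>i. m \<le> i \<Longrightarrow> f i = 0"
  shows "tableau_sum x (Suc a) (shape_boxes f) =
    (\<Sum>g\<in>interlacing f. (\<Prod>b\<in>shape_boxes f - shape_boxes g. x (Suc a) b) * tableau_sum x a (shape_boxes g))"
proof -
  let ?D = "shape_boxes f"
  let ?w = "\<lambda>g T. (\<Prod>b\<in>?D - shape_boxes g. x (Suc a) b) * (\<Prod>b\<in>shape_boxes g. x (T b) b)"
  have fin: "finite ?D" by (rule finite_shape_boxes[OF f0])
  have sub: "shape_boxes g \<subseteq> ?D" if "g \<in> interlacing f" for g
    using that by (rule interlacing_shape_boxes_subset)
  have weight: "(\<Prod>b\<in>?D. x (T b) b) = ?w (sub_shape a ?D T) T" if T: "T \<in> tableaux (Suc a) ?D" for T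
  proof -
    let ?G = "shape_boxes (sub_shape a ?D T)"
    have G: "?G = {b \<in> ?D. T b \<le> a}" by (rule shape_boxes_sub_shape[OF T])
    have "T b = Suc a" if "b \<in> ?D - ?G" for b
      using that T unfolding G by (auto simp: tableaux_def PiE_iff le_Suc_eq dest!: bspec)
    then have "(\<Prod>b\<in>?D - ?G. x (T b) b) = (\<Prod>b\<in>?D - ?G. x (Suc a) b)" by simp
    then show ?thesis
      using prod.subset_diff[of ?G ?D "\<lambda>b. x (T b) b"] fin by (simp add: G)
  qed
  have "tableau_sum x (Suc a) ?D =
      (\<Sum>(g, T)\<in>(SIGMA g:interlacing f. tableaux a (shape_boxes g)). ?w g T)"
    unfolding tableau_sum_def
  proof (rule sum.reindex_bij_witness[where
        i = "\<lambda>(g, T). \<lambda>b\<in>?D. if b \<in> shape_boxes g then T b else Suc a" and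
        j = "\<lambda>T. (sub_shape a ?D T, restrict T (shape_boxes (sub_shape a ?D T)))"])
    fix T assume T: "T \<in> tableaux (Suc a) ?D"
    note G = shape_boxes_sub_shape[OF T, of a]
    show "(case (sub_shape a ?D T, restrict T (shape_boxes (sub_shape a ?D T))) of
        (g, T) \<Rightarrow> \<lambda>b\<in>?D. if b \<in> shape_boxes g then T b else Suc a) = T"
    proof (rule ext)
      fix b show "(case (sub_shape a ?D T, restrict T (shape_boxes (sub_shape a ?D T))) of
        (g, T) \<Rightarrow> \<lambda>b\<in>?D. if b \<in> shape_boxes g then T b else Suc a) b = T b"
      proof (cases "b \<in> ?D")
        case True
        then have "T b \<in> {1..Suc a}" using T by (auto simp: tableaux_def PiE_iff)
        then show ?thesis using True by (auto simp: G le_Suc_eq)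
      next
        case False
        then show ?thesis using T by (cases b) (auto simp: tableaux_def PiE_iff extensional_def)
      qed
    qed
    show "(sub_shape a ?D T, restrict T (shape_boxes (sub_shape a ?D T)))
        \<in> (SIGMA g:interlacing f. tableaux a (shape_boxes g))"
    proof (rule SigmaI)
      show "sub_shape a ?D T \<in> interlacing f" by (rule sub_shape_interlacing[OF f T])
      show "restrict T (shape_boxes (sub_shape a ?D T)) \<in> tableaux a (shape_boxes (sub_shape a ?D T))"
        unfolding G by (rule tableaux_restrict[OF T]) auto
    qed
    show "(case (sub_shape a ?D T, restrict T (shape_boxes (sub_shape a ?D T))) of (g, T) \<Rightarrow> ?w g T) =
        (\<Prod>b\<in>?D. x (T b) b)"
      by (simp add: weight[OF T])
  next
    fix p assume "p \<in> (SIGMA g:interlacing f. tableaux a (shape_boxes g))"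
    then obtain g T where p: "p = (g, T)" and g: "g \<in> interlacing f" and T: "T \<in> tableaux a (shape_boxes g)"
      by auto
    define T' where "T' = (\<lambda>b\<in>?D. if b \<in> shape_boxes g then T b else Suc a)"
    have T': "T' \<in> tableaux (Suc a) ?D"
      unfolding T'_def by (rule extend_tableau[OF f g T])
    then show "(case p of (g, T) \<Rightarrow> \<lambda>b\<in>?D. if b \<in> shape_boxes g then T b else Suc a) \<in> tableaux (Suc a) ?D"
      by (simp add: p T'_def)
    have "shape_boxes (sub_shape a ?D T') = {b \<in> ?D. T' b \<le> a}"
      by (rule shape_boxes_sub_shape[OF T'])
    also have "\<dots> = shape_boxes g"
      using sub[OF g] T by (auto simp: T'_def tableaux_def PiE_iff split: if_splits)
    finally have *: "sub_shape a ?D T' = g"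
      by (rule injD[OF inj_shape_boxes])
    have "restrict T' (shape_boxes g) = T"
    proof (rule extensionalityI)
      show "T \<in> extensional (shape_boxes g)" using T by (simp add: tableaux_def PiE_iff)
      show "restrict T' (shape_boxes g) b = T b" if "b \<in> shape_boxes g" for b
        using that sub[OF g] by (auto simp: T'_def)
    qed simp
    with * show "(sub_shape a ?D (case p of (g, T) \<Rightarrow> \<lambda>b\<in>?D. if b \<in> shape_boxes g then T b else Suc a),
         restrict (case p of (g, T) \<Rightarrow> \<lambda>b\<in>?D. if b \<in> shape_boxes g then T b else Suc a)
          (shape_boxes (sub_shape a ?D (case p of (g, T) \<Rightarrow> \<lambda>b\<in>?D. if b \<in> shape_boxes g then T b else Suc a)))) = p"
      by (simp add: p T'_def)
  qed
  also have "\<dots> = (\<Sum>g\<in>interlacing f. \<Sum>T\<in>tableaux a (shape_boxes g). ?w g T)"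
  proof (rule sum.Sigma[symmetric])
    show "finite (interlacing f)" by (rule finite_interlacing[OF f0])
    show "\<forall>g\<in>interlacing f. finite (tableaux a (shape_boxes g))"
      using finite_subset[OF sub fin] by (auto intro: finite_tableaux)
  qed
  also have "\<dots> = (\<Sum>g\<in>interlacing f. (\<Prod>b\<in>?D - shape_boxes g. x (Suc a) b) * tableau_sum x a (shape_boxes g))"
    by (simp add: tableau_sum_def sum_distrib_left)
  finally show ?thesis .
qed

lemma tableau_sum_0: "tableau_sum x 0 D = (if D = {} then 1 else 0)"
proof (cases "D = {}")
  case True
  have "tableaux 0 D = {\<lambda>_. undefined}" using True by (auto simp: tableaux_def)
  then show ?thesis using True by (simp add: tableau_sum_def)
next
  case False
  then have "tableaux 0 D = {}" by (auto simp: tableaux_def PiE_iff)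
  then show ?thesis using False by (simp add: tableau_sum_def)
qed

section \<open>Tableaux and determinants\<close>

text \<open>
  Meaningful for \<open>i < m\<close> only. Rows are counted from 0 here, but from 1 in \<open>shape_boxes\<close>.
\<close>

definition bead :: "nat \<Rightarrow> (nat \<Rightarrow> nat) \<Rightarrow> nat \<Rightarrow> nat" where
  "bead m f i = f i + (m - Suc i)"

text \<open>The determinantal twin of \<open>tableau_sum_Suc\<close>. The unitriangular
  \<open>U\<close> reduces row \<open>i\<close> to a sum over the interval \<open>B i\<close>
  between consecutive beads. One position from each interval is the same as the beads of a shape
  interlacing with \<open>f\<close>.\<close>

lemma row_det_basis_seq_Suc:
  assumes f: "antimono f" and f0: "\<And>i. m \<le> i \<Longrightarrow> f i = 0"
  shows "row_det m (basis_seq y m (Suc a)) (bead m f) =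
    (\<Sum>g\<in>interlacing f. (\<Prod>i<m. \<Prod>p\<in>{bead m g i<..bead m f i}. y (Suc a) p)
      * row_det m (basis_seq y m a) (bead m g))"
proof -
  let ?x = "y (Suc a)" and ?F = "basis_seq y m (Suc a)" and ?c = "bead m f"
  define A where "A = mat m m (\<lambda>(i, j). ?F j (?c i))"
  define U where "U = mat m m (\<lambda>(i, j). if i = j then 1
    else if j = Suc i then - (\<Prod>p\<in>{?c (Suc i)<..?c i}. ?x p) else 0)"
  \<comment> \<open>The last row has no next bead to subtract, so its interval goes down to
    0.\<close>
  define B where "B i = (if Suc i < m then {?c (Suc i)<..?c i} else {..?c i})" for i
  let ?w = "\<lambda>i b. \<Prod>p\<in>{b<..?c i}. ?x p"
  have carrier: "A \<in> carrier_mat m m" "U \<in> carrier_mat m m" by (simp_all add: A_def U_def)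
  have "det U = prod_list (diag_mat U)"
    by (rule det_upper_triangular[OF _ carrier(2)]) (auto simp: U_def)
  also have "diag_mat U = replicate m 1"
    by (rule nth_equalityI) (auto simp: diag_mat_def U_def)
  finally have "det U = 1" by simp
  have UA: "U * A = mat m m (\<lambda>(i, j). \<Sum>b\<in>B i. ?w i b * basis_seq y m a j b)"
  proof (rule eq_matI)
    fix i j assume "i < dim_row (mat m m (\<lambda>(i, j). \<Sum>b\<in>B i. ?w i b * basis_seq y m a j b))"
      "j < dim_col (mat m m (\<lambda>(i, j). \<Sum>b\<in>B i. ?w i b * basis_seq y m a j b))"
    then have ij: "i < m" "j < m" by simp_all
    have "(U * A) $$ (i, j) = (\<Sum>l<m. U $$ (i, l) * A $$ (l, j))"
      using ij carrier by (simp add: scalar_prod_def lessThan_atLeast0)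
    also have "\<dots> = (\<Sum>l<m. (if l = i then ?F j (?c i) else 0) +
        (if l = Suc i then - ?w i (?c (Suc i)) * ?F j (?c (Suc i)) else 0))"
      using ij by (intro sum.cong refl) (auto simp: U_def A_def)
    also have "\<dots> = ?F j (?c i) + (if Suc i < m then - ?w i (?c (Suc i)) * ?F j (?c (Suc i)) else 0)"
      using ij by (simp add: sum.distrib)
    also have "\<dots> = (\<Sum>b\<in>B i. ?w i b * basis_seq y m a j b)"
    proof (cases "Suc i < m")
      case True
      have "?c (Suc i) \<le> ?c i"
        using antimonoD[OF f, of i "Suc i"] by (simp add: bead_def)
      from transfer_split[OF this, of ?x "basis_seq y m a j"] True show ?thesis
        by (simp add: B_def)
    next
      case False
      then show ?thesis by (simp add: B_def transfer_eq_sum)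
    qed
    finally show "(U * A) $$ (i, j) = mat m m (\<lambda>(i, j). \<Sum>b\<in>B i. ?w i b * basis_seq y m a j b) $$ (i, j)"
      using ij by simp
  qed (simp_all add: U_def A_def)
  have "row_det m ?F ?c = det (U * A)"
    using det_mult[OF carrier(2,1)] \<open>det U = 1\<close> by (simp add: row_det_def A_def)
  also have "\<dots> = (\<Sum>b\<in>PiE {..<m} B. (\<Prod>i<m. ?w i (b i)) * row_det m (basis_seq y m a) b)"
    unfolding UA by (rule det_sum_rows) (simp add: B_def)
  also have "\<dots> = (\<Sum>g\<in>interlacing f. (\<Prod>i<m. ?w i (bead m g i)) * row_det m (basis_seq y m a) (bead m g))"
  proof (rule sum.reindex_bij_witness[where i = "\<lambda>g. restrict (bead m g) {..<m}" and
        j = "\<lambda>b i. if i < m then b i - (m - Suc i) else 0"])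
    fix b assume b: "b \<in> PiE {..<m} B"
    let ?g = "\<lambda>i. if i < m then b i - (m - Suc i) else 0"
    \<comment> \<open>The strict lower end of \<open>B i\<close> absorbs the difference 1 between
      the offsets of neighbouring beads, so the subtraction is not truncated.\<close>
    have bi: "m - Suc i \<le> b i \<and> f (Suc i) \<le> b i - (m - Suc i) \<and> b i - (m - Suc i) \<le> f i" if "i < m" for i
    proof -
      have "b i \<in> B i" using b that by auto
      then show ?thesis
        using that f0[of "Suc i"] by (auto simp: B_def bead_def split: if_splits)
    qed
    have bead: "bead m ?g i = b i" if "i < m" for i
      by (simp only: bead_def that if_True bi[OF that] le_add_diff_inverse2)
    then show "restrict (bead m ?g) {..<m} = b"
      using b by (auto simp: fun_eq_iff PiE_iff extensional_def)
    show "?g \<in> interlacing f"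
      using bi f0 by (auto simp: interlacing_def)
    show "(\<Prod>i<m. ?w i (bead m ?g i)) * row_det m (basis_seq y m a) (bead m ?g) =
        (\<Prod>i<m. ?w i (b i)) * row_det m (basis_seq y m a) b"
      by (simp add: bead row_det_cong[of m "bead m ?g" b])
  next
    fix g assume g: "g \<in> interlacing f"
    have "bead m g i \<in> B i" if "i < m" for i
    proof -
      have "f (Suc i) \<le> g i" "g i \<le> f i" using g by (auto simp: interlacing_def)
      then show ?thesis using that by (auto simp: B_def bead_def)
    qed
    then show "restrict (bead m g) {..<m} \<in> PiE {..<m} B"
      by auto
    show "(\<lambda>i. if i < m then restrict (bead m g) {..<m} i - (m - Suc i) else 0) = g"
      using interlacing_eq_0[OF f0 g] by (auto simp: fun_eq_iff bead_def)
  qed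
  finally show ?thesis .
qed

text \<open>The box in row \<open>i\<close> and column \<open>j\<close> is the step of bead
  \<open>i - 1\<close> to position \<open>j + m - i\<close>.\<close>

lemma prod_skew_shape_boxes:
  assumes g: "g \<in> interlacing f" and f0: "\<And>i. m \<le> i \<Longrightarrow> f i = 0"
  shows "(\<Prod>(i, j)\<in>shape_boxes f - shape_boxes g. x (j + m - i)) =
    (\<Prod>i<m. \<Prod>p\<in>{bead m g i<..bead m f i}. x p)"
proof -
  have "(\<Prod>i<m. \<Prod>p\<in>{bead m g i<..bead m f i}. x p) =
      (\<Prod>(i, p)\<in>(SIGMA i:{..<m}. {bead m g i<..bead m f i}). x p)"
    by (rule prod.Sigma) auto
  also have "\<dots> = (\<Prod>(i, j)\<in>shape_boxes f - shape_boxes g. x (j + m - i))"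
  proof (rule prod.reindex_bij_witness[where i = "\<lambda>(i, j). (i - 1, j + m - i)" and
        j = "\<lambda>(i, p). (Suc i, p - (m - Suc i))"])
    fix b assume b: "b \<in> shape_boxes f - shape_boxes g"
    then obtain i j where ij: "b = (Suc i, j)" "g i < j" "j \<le> f i"
      by (rule skew_shape_boxesE)
    then have "i < m" using f0[of i] by (cases "i < m") auto
    then show "(case case b of (i, j) \<Rightarrow> (i - 1, j + m - i) of (i, p) \<Rightarrow> (Suc i, p - (m - Suc i))) = b"
      "(case b of (i, j) \<Rightarrow> (i - 1, j + m - i)) \<in> (SIGMA i:{..<m}. {bead m g i<..bead m f i})"
      using ij by (auto simp: bead_def)
  qed (auto simp: bead_def shape_boxes_def)
  finally show ?thesis ..
qed

text \<open>
  A Jacobi--Trudi formula: subtracting from each row a multiple of the next one turns the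
  determinant for one more variable into the branching rule for tableaux.
\<close>

lemma tableau_sum_eq_row_det:
  assumes "antimono f" and "\<And>i. m \<le> i \<Longrightarrow> f i = 0"
  shows "tableau_sum (\<lambda>a (i, j). y a (j + m - i)) a (shape_boxes f) =
    row_det m (basis_seq y m a) (bead m f)"
  using assms
proof (induction a arbitrary: f)
  case 0
  show ?case
  proof (cases "f = (\<lambda>_. 0)")
    case True
    have "row_det m (basis_seq y m 0) (bead m f) = det (1\<^sub>m m)"
      unfolding row_det_def True
      by (intro arg_cong[where f = det] eq_matI) (auto simp: bead_def unit_seq_def)
    moreover have "shape_boxes f = {}" using True by (auto simp: shape_boxes_def)
    ultimately show ?thesis by (simp add: tableau_sum_0 del: basis_seq.simps)
  next
    case False
    then obtain i where "f i \<noteq> 0" by auto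
    then have f0: "f 0 \<noteq> 0" using antimonoD[OF 0(1), of 0 i] by auto
    then have m: "0 < m" using 0(2)[of 0] by (cases m) auto
    \<comment> \<open>The first bead is at least \<open>m\<close>, beyond the support of all the
      unit sequences, so row 0 is zero.\<close>
    have "row_det m (basis_seq y m 0) (bead m f) = 0"
      unfolding row_det_def using m f0
      by (subst laplace_expansion_row[of _ m 0])
         (auto simp: bead_def unit_seq_def intro!: sum.neutral)
    moreover have "(1, 1) \<in> shape_boxes f" using f0 by (auto simp: shape_boxes_def)
    ultimately show ?thesis by (auto simp: tableau_sum_0 simp del: basis_seq.simps)
  qed
next
  case (Suc a)
  let ?x = "\<lambda>a (i, j). y a (j + m - i)"
  have "tableau_sum ?x (Suc a) (shape_boxes f) =
    (\<Sum>g\<in>interlacing f. (\<Prod>b\<in>shape_boxes f - shape_boxes g. ?x (Suc a) b) *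
      tableau_sum ?x a (shape_boxes g))"
    by (rule tableau_sum_Suc) (fact Suc.prems)+
  also have "\<dots> = (\<Sum>g\<in>interlacing f. (\<Prod>i<m. \<Prod>p\<in>{bead m g i<..bead m f i}. y (Suc a) p)
      * row_det m (basis_seq y m a) (bead m g))"
  proof (intro sum.cong refl)
    fix g assume g: "g \<in> interlacing f"
    have "tableau_sum ?x a (shape_boxes g) = row_det m (basis_seq y m a) (bead m g)"
      using interlacing_eq_0[OF Suc.prems(2) g] by (intro Suc.IH interlacing_antimono[OF g])
    moreover have "(\<Prod>b\<in>shape_boxes f - shape_boxes g. ?x (Suc a) b) =
        (\<Prod>i<m. \<Prod>p\<in>{bead m g i<..bead m f i}. y (Suc a) p)"
      by (rule prod_skew_shape_boxes[OF g]) (fact Suc.prems)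
    ultimately show "(\<Prod>b\<in>shape_boxes f - shape_boxes g. ?x (Suc a) b) * tableau_sum ?x a (shape_boxes g) =
      (\<Prod>i<m. \<Prod>p\<in>{bead m g i<..bead m f i}. y (Suc a) p) * row_det m (basis_seq y m a) (bead m g)"
      by simp
  qed
  also have "\<dots> = row_det m (basis_seq y m (Suc a)) (bead m f)"
    by (rule row_det_basis_seq_Suc[symmetric]) (fact Suc.prems)+
  finally show ?case .
qed

section \<open>Partitions as functions\<close>

definition parts :: "nat list \<Rightarrow> nat \<Rightarrow> nat" where
  "parts lam i = (if i < length lam then lam ! i else 0)"

lemma young_diagram_eq_shape_boxes: "young_diagram lam = shape_boxes (parts lam)"
  by (auto simp: young_diagram_def shape_boxes_def parts_def split: if_splits)

lemma antimono_parts: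
  assumes "is_partition lam"
  shows "antimono (parts lam)"
proof (rule antimonoI)
  fix i j :: nat assume "i \<le> j"
  then show "parts lam j \<le> parts lam i"
    using assms by (cases "i = j") (auto simp: is_partition_def parts_def sorted_wrt_iff_nth_less)
qed

lemma parts_pos_iff:
  assumes "is_partition lam"
  shows "0 < parts lam i \<longleftrightarrow> i < length lam"
  using assms by (auto simp: is_partition_def parts_def)

text \<open>Parts are positive, so the length can be read off from the support of the padded
  function.\<close>

lemma inj_on_parts: "inj_on parts {lam. is_partition lam}"
proof (rule inj_onI, clarify)
  fix lam mu assume "is_partition lam" "is_partition mu" "parts lam = parts mu"
  then have len: "i < length lam \<longleftrightarrow> i < length mu" for i
    using parts_pos_iff[of lam i] parts_pos_iff[of mu i] by simp
  have "length lam = length mu"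
    using len[of "length lam"] len[of "length mu"] by simp
  then show "lam = mu"
    using \<open>parts lam = parts mu\<close> by (auto intro!: nth_equalityI simp: parts_def fun_eq_iff)
       (metis)
qed

lemma obtain_partition_of_shape:
  assumes f: "antimono f" and f0: "\<And>i. m \<le> i \<Longrightarrow> f i = 0"
  obtains mu where "is_partition mu" "length mu \<le> m" "parts mu = f"
proof
  define N where "N = (LEAST i. f i = 0)"
  have N: "f N = 0" unfolding N_def by (rule LeastI[of _ m]) (simp add: f0)
  have less: "0 < f i" if "i < N" for i
    using not_less_Least[of i "\<lambda>i. f i = 0"] that by (simp add: N_def)
  have ge: "f i = 0" if "N \<le> i" for i
    using antimonoD[OF f that] N by simp
  show "is_partition (map f [0..<N])"
    using less antimonoD[OF f] by (auto simp: is_partition_def sorted_wrt_iff_nth_less)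
  show "length (map f [0..<N]) \<le> m"
    unfolding N_def by (simp add: Least_le f0)
  show "parts (map f [0..<N]) = f"
    using ge by (auto simp: parts_def fun_eq_iff)
qed

section \<open>Ribbons\<close>

lemma card_skew_shape_boxes:
  assumes "finite L" "\<And>l. f l < g l \<Longrightarrow> l \<in> L"
  shows "card (shape_boxes g - shape_boxes f) = (\<Sum>l\<in>L. g l - f l)"
proof -
  have "shape_boxes g - shape_boxes f = (\<lambda>(l, j). (Suc l, j)) ` (SIGMA l:L. {f l<..g l})"
  proof (intro equalityI subsetI)
    fix b assume "b \<in> shape_boxes g - shape_boxes f"
    then obtain l j where b: "b = (Suc l, j)" "f l < j" "j \<le> g l"
      by (rule skew_shape_boxesE)
    then have "(l, j) \<in> (SIGMA l:L. {f l<..g l})" using assms(2)[of l] by auto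
    then show "b \<in> (\<lambda>(l, j). (Suc l, j)) ` (SIGMA l:L. {f l<..g l})" using b by force
  qed (auto simp: shape_boxes_def)
  moreover have "inj_on (\<lambda>(l, j). (Suc l, j :: nat)) (SIGMA l:L. {f l<..g l})"
    by (auto simp: inj_on_def)
  ultimately show ?thesis using assms(1) by (simp add: card_image)
qed

text \<open>The relation between consecutive rows makes the sums telescope. Once the size of the
  ribbon is known, this determines its first row \<open>g h\<close>.\<close>

lemma sum_ribbon_rows:
  fixes f g :: "nat \<Rightarrow> nat"
  assumes "h \<le> i" "\<And>l. h \<le> l \<Longrightarrow> l < i \<Longrightarrow> g (Suc l) = Suc (f l)"
  shows "(\<Sum>l=h..i. g l) + f i = g h + (i - h) + (\<Sum>l=h..i. f l)"
  using assms by (induction i rule: dec_induct) (simp_all add: Suc_diff_le)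

text \<open>
  In terms of beads, \<open>ribbon_fits f K h i\<close> says that moving the \<open>i\<close>-th bead \<open>K\<close> places up
  makes it the \<open>h\<close>-th one.
\<close>

definition ribbon_fits :: "(nat \<Rightarrow> nat) \<Rightarrow> nat \<Rightarrow> nat \<Rightarrow> nat \<Rightarrow> bool" where
  "ribbon_fits f K h i \<longleftrightarrow> h \<le> i \<and> f h + i < f i + K + h \<and> (h = 0 \<or> f i + K + h \<le> f (h - 1) + i)"

text \<open>In beads: place \<open>h\<close> receives bead \<open>i\<close> raised by
  \<open>K\<close>, and places \<open>h + 1\<close> to \<open>i\<close> receive the bead of the row
  before. Offsets of neighbouring rows differ by 1, hence the \<open>Suc\<close>.\<close>

definition add_ribbon :: "(nat \<Rightarrow> nat) \<Rightarrow> nat \<Rightarrow> nat \<Rightarrow> nat \<Rightarrow> nat \<Rightarrow> nat" where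
  "add_ribbon f K h i = (\<lambda>l. if l = h then f i + K + h - i
     else if h < l \<and> l \<le> i then Suc (f (l - 1)) else f l)"

lemma add_ribbon_Suc: "h \<le> l \<Longrightarrow> l < i \<Longrightarrow> add_ribbon f K h i (Suc l) = Suc (f l)"
  by (simp add: add_ribbon_def)

lemma add_ribbon_greater_iff:
  assumes f: "antimono f" and fits: "ribbon_fits f K h i"
  shows "f l < add_ribbon f K h i l \<longleftrightarrow> h \<le> l \<and> l \<le> i"
  using fits antimonoD[OF f, of "l - 1" l] by (auto simp: add_ribbon_def ribbon_fits_def)

lemma add_ribbon_outside: "\<not> (h \<le> l \<and> l \<le> i) \<Longrightarrow> h \<le> i \<Longrightarrow> add_ribbon f K h i l = f l"
  by (auto simp: add_ribbon_def)

lemma antimono_add_ribbon: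
  assumes f: "antimono f" and fits: "ribbon_fits f K h i"
  shows "antimono (add_ribbon f K h i)"
proof (intro antimono_iff_le_Suc[THEN iffD2] allI)
  fix l
  show "add_ribbon f K h i (Suc l) \<le> add_ribbon f K h i l"
    using fits antimonoD[OF f, of l "Suc l"] antimonoD[OF f, of "l - 1" l]
    by (auto simp: add_ribbon_def ribbon_fits_def)
qed

lemma le_add_ribbon:
  assumes "antimono f" "ribbon_fits f K h i"
  shows "f \<le> add_ribbon f K h i"
proof (rule le_funI)
  fix l show "f l \<le> add_ribbon f K h i l"
    using add_ribbon_greater_iff[OF assms, of l] add_ribbon_outside[of h l i f K] assms(2)
    by (cases "h \<le> l \<and> l \<le> i") (auto simp: ribbon_fits_def)
qed

lemma card_add_ribbon:
  assumes f: "antimono f" and fits: "ribbon_fits f K h i"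
  shows "card (shape_boxes (add_ribbon f K h i) - shape_boxes f) = K"
proof -
  let ?g = "add_ribbon f K h i"
  have hi: "h \<le> i" using fits by (simp add: ribbon_fits_def)
  have "card (shape_boxes ?g - shape_boxes f) = (\<Sum>l=h..i. ?g l - f l)"
    by (rule card_skew_shape_boxes) (simp_all add: add_ribbon_greater_iff[OF f fits])
  also have "\<dots> = (\<Sum>l=h..i. ?g l) - (\<Sum>l=h..i. f l)"
    using le_add_ribbon[OF f fits] by (intro sum_subtractf_nat) (simp add: le_fun_def)
  also have "\<dots> = K"
    using sum_ribbon_rows[OF hi, of ?g f] fits
    by (simp add: add_ribbon_Suc) (simp add: add_ribbon_def ribbon_fits_def)
  finally show ?thesis .
qed

lemma ribbon_height_add_ribbon:
  assumes f: "antimono f" and fits: "ribbon_fits f K h i"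
  shows "ribbon_height (shape_boxes (add_ribbon f K h i) - shape_boxes f) = i - h"
proof -
  let ?S = "shape_boxes (add_ribbon f K h i) - shape_boxes f"
  have "fst ` ?S = Suc ` {h..i}"
  proof (intro equalityI subsetI)
    fix k assume "k \<in> fst ` ?S"
    then obtain l j where "k = Suc l" "f l < j" "j \<le> add_ribbon f K h i l"
      by (auto elim!: skew_shape_boxesE)
    then show "k \<in> Suc ` {h..i}"
      using add_ribbon_greater_iff[OF f fits, of l] by auto
  next
    fix k assume "k \<in> Suc ` {h..i}"
    then obtain l where l: "k = Suc l" "h \<le> l" "l \<le> i" by (elim imageE) simp
    then have "(Suc l, Suc (f l)) \<in> ?S"
      using add_ribbon_greater_iff[OF f fits, of l] unfolding mem_skew_shape_boxes by simp
    then show "k \<in> fst ` ?S" using l by force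
  qed
  then show ?thesis
    using fits by (simp add: ribbon_height_def card_image ribbon_fits_def)
qed

text \<open>By \<open>add_ribbon_Suc\<close> the last new box of a row lies directly below the first
  new box of the row before. Consecutive rows thus meet in one column: enough to connect every box
  to the first new box of row \<open>h\<close>, too little for a square.\<close>

lemma is_ribbon_add_ribbon:
  assumes f: "antimono f" and fits: "ribbon_fits f K h i"
  shows "is_ribbon (shape_boxes (add_ribbon f K h i) - shape_boxes f)"
proof -
  define g where "g = add_ribbon f K h i"
  define S where "S = shape_boxes g - shape_boxes f"
  define R where "R = {(p, q). p \<in> S \<and> q \<in> S \<and> box_adjacent p q}"
  note greater = add_ribbon_greater_iff[OF f fits, folded g_def]
  have mem: "(Suc l, j) \<in> S \<longleftrightarrow> f l < j \<and> j \<le> g l" for l j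
    unfolding S_def by (rule mem_skew_shape_boxes)
  have "sym R" by (auto simp: R_def box_adjacent_def sym_def)
  then have sym: "sym (R\<^sup>*)" by (rule sym_rtrancl)
  have row: "((Suc l, j), (Suc l, Suc (f l))) \<in> R\<^sup>*" if "Suc (f l) \<le> j" "j \<le> g l" for l j
    using that
  proof (induction j rule: dec_induct)
    case (step j)
    have "((Suc l, Suc j), (Suc l, j)) \<in> R"
      using step by (simp add: R_def mem box_adjacent_def)
    then show ?case using step by (simp add: converse_rtrancl_into_rtrancl)
  qed simp
  have base: "((Suc l, Suc (f l)), (Suc h, Suc (f h))) \<in> R\<^sup>*" if "h \<le> l" "l \<le> i" for l
    using that
  proof (induction l rule: dec_induct)
    case (step l)
    have g: "g (Suc l) = Suc (f l)" using step by (simp add: g_def add_ribbon_Suc)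
    have gr: "f l < g l" "f (Suc l) < g (Suc l)" using step by (simp_all add: greater)
    have "((Suc (Suc l), g (Suc l)), (Suc l, Suc (f l))) \<in> R"
      using gr by (simp add: R_def mem box_adjacent_def g)
    moreover have "((Suc (Suc l), g (Suc l)), (Suc (Suc l), Suc (f (Suc l)))) \<in> R\<^sup>*"
      using gr by (intro row) auto
    ultimately have "((Suc (Suc l), Suc (f (Suc l))), (Suc l, Suc (f l))) \<in> R\<^sup>*"
      by (meson symD[OF sym] r_into_rtrancl rtrancl_trans)
    then show ?case using step by (auto intro: rtrancl_trans)
  qed simp
  have root: "(b, (Suc h, Suc (f h))) \<in> R\<^sup>*" if "b \<in> S" for b
  proof -
    obtain l j where b: "b = (Suc l, j)" "f l < j" "j \<le> g l"
      using \<open>b \<in> S\<close> unfolding S_def by (rule skew_shape_boxesE)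
    then have "h \<le> l" "l \<le> i" using greater[of l] by auto
    then show ?thesis
      using row[of l j] base[of l] b by (auto intro: rtrancl_trans)
  qed
  then have "box_connected S"
    unfolding box_connected_def R_def[symmetric] by (meson symD[OF sym] rtrancl_trans)
  moreover have "\<not> has_two_by_two S"
  proof
    assume "has_two_by_two S"
    then obtain k j where sq: "{(k, j), (k, j + 1), (k + 1, j), (k + 1, j + 1)} \<subseteq> S"
      by (auto simp: has_two_by_two_def)
    then have "(k, j) \<in> shape_boxes g - shape_boxes f" by (simp add: S_def)
    then obtain l where k: "k = Suc l" by (rule skew_shape_boxesE) simp
    have b: "f l < j" "j \<le> g l" "f (Suc l) < j + 1" "j + 1 \<le> g (Suc l)"
      using sq by (auto simp: k mem)
    then have "h \<le> l" "Suc l \<le> i" using greater[of l] greater[of "Suc l"] by auto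
    then show False using b by (simp add: g_def add_ribbon_Suc)
  qed
  ultimately show ?thesis by (simp add: is_ribbon_def S_def g_def)
qed

text \<open>Take \<open>h\<close> and \<open>i\<close> to be the first and last rows that gain
  boxes. Connectedness makes consecutive rows overlap, the absence of squares limits the overlap to
  one column, and the size then fixes row \<open>h\<close>.\<close>

lemma ribbon_eq_add_ribbon:
  assumes f: "antimono f" and g: "antimono g" and g0: "\<And>i. m \<le> i \<Longrightarrow> g i = 0" and le: "f \<le> g"
    and ribbon: "is_ribbon (shape_boxes g - shape_boxes f)"
    and card: "card (shape_boxes g - shape_boxes f) = K" and K: "K \<ge> 1"
  shows "\<exists>h i. i < m \<and> ribbon_fits f K h i \<and> g = add_ribbon f K h i"
proof -
  define S where "S = shape_boxes g - shape_boxes f"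
  define L where "L = {l. f l < g l}"
  define h where "h = Min L"
  define i where "i = Max L"
  have mem: "(Suc l, j) \<in> S \<longleftrightarrow> f l < j \<and> j \<le> g l" for l j
    unfolding S_def by (rule mem_skew_shape_boxes)
  have L_less: "l < m" if "l \<in> L" for l
    using that g0[of l] by (cases "l < m") (auto simp: L_def)
  have finL: "finite L" by (rule finite_subset[of _ "{..<m}"]) (auto dest: L_less)
  have cardL: "(\<Sum>l\<in>L. g l - f l) = K"
    using card_skew_shape_boxes[OF finL, of f g] card by (simp add: L_def)
  then have "L \<noteq> {}" using K by auto
  then have hL: "h \<in> L" and iL: "i \<in> L" and hi: "h \<le> i"
    and range: "\<And>l. l \<in> L \<Longrightarrow> h \<le> l \<and> l \<le> i"
    using finL by (auto simp: h_def i_def)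
  have outside: "g l = f l" if "\<not> (h \<le> l \<and> l \<le> i)" for l
    using range[of l] that le by (force simp: L_def le_fun_def not_less intro: antisym)
  have step: "g (Suc l) = Suc (f l)" if l: "h \<le> l" "l < i" for l
  proof -
    have "f l < g (Suc l)"
    proof (rule ccontr)
      assume *: "\<not> f l < g (Suc l)"
      \<comment> \<open>Without a common column, no path crosses from diagram row
        \<open>Suc l\<close> to the next; diagram rows are counted from 1.\<close>
      have closed: "fst q \<le> Suc l"
        if "(p, q) \<in> {(p, q). p \<in> S \<and> q \<in> S \<and> box_adjacent p q}\<^sup>*" "fst p \<le> Suc l" for p q
        using that
      proof (induction rule: rtrancl_induct)
        case (step p q)
        show ?case
        proof (rule ccontr)
          assume "\<not> fst q \<le> Suc l"
          then have "fst q = Suc (Suc l)" "fst p = Suc l" "snd q = snd p"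
            using step by (auto simp: box_adjacent_def)
          moreover have "p \<in> S" "q \<in> S" using step by auto
          ultimately have "(Suc l, snd p) \<in> S" "(Suc (Suc l), snd p) \<in> S"
            by (metis prod.collapse)+
          then show False using * by (simp add: mem)
        qed
      qed simp
      have "(Suc h, g h) \<in> S" "(Suc i, g i) \<in> S"
        using hL iL by (simp_all add: mem L_def)
      then have "((Suc h, g h), (Suc i, g i)) \<in> {(p, q). p \<in> S \<and> q \<in> S \<and> box_adjacent p q}\<^sup>*"
        using ribbon unfolding is_ribbon_def box_connected_def S_def[symmetric] by blast
      from closed[OF this] show False using l by simp
    qed
    moreover have "g (Suc l) \<le> Suc (f l)"
    proof (rule ccontr)
      assume *: "\<not> g (Suc l) \<le> Suc (f l)"
      have "g (Suc l) \<le> g l" "f (Suc l) \<le> f l"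
        using antimonoD[OF f, of l "Suc l"] antimonoD[OF g, of l "Suc l"] by simp_all
      then have "{(Suc l, Suc (f l)), (Suc l, Suc (f l) + 1), (Suc l + 1, Suc (f l)), (Suc l + 1, Suc (f l) + 1)} \<subseteq> S"
        using * by (simp add: mem)
      then have "has_two_by_two S" unfolding has_two_by_two_def by blast
      then show False using ribbon by (simp add: is_ribbon_def S_def)
    qed
    ultimately show ?thesis by simp
  qed
  have "(\<Sum>l=h..i. g l - f l) = K"
    unfolding cardL[symmetric]
  proof (rule sum.mono_neutral_right)
    show "L \<subseteq> {h..i}" using range by auto
    show "\<forall>l\<in>{h..i} - L. g l - f l = 0" by (simp add: L_def)
  qed simp
  moreover have "(\<Sum>l=h..i. g l - f l) = (\<Sum>l=h..i. g l) - (\<Sum>l=h..i. f l)"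
    using le by (intro sum_subtractf_nat) (simp add: le_fun_def)
  moreover have "(\<Sum>l=h..i. f l) \<le> (\<Sum>l=h..i. g l)"
    using le by (intro sum_mono) (simp add: le_fun_def)
  ultimately have gh: "g h + i = f i + K + h"
    using sum_ribbon_rows[OF hi, of g f] step hi by simp
  have "ribbon_fits f K h i"
    unfolding ribbon_fits_def
  proof (intro conjI)
    show "f h + i < f i + K + h" using hL gh by (simp add: L_def)
    show "h = 0 \<or> f i + K + h \<le> f (h - 1) + i"
      using antimonoD[OF g, of "h - 1" h] outside[of "h - 1"] gh by (cases "h = 0") auto
  qed (rule hi)
  moreover have "g l = add_ribbon f K h i l" for l
    using gh outside[of l] step[of "l - 1"] by (auto simp: add_ribbon_def)
  ultimately show ?thesis
    using L_less[OF iL] by blast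
qed

text \<open>\<open>h\<close> and \<open>i\<close> are recovered as the first and last rows that gain
  boxes.\<close>

lemma add_ribbon_inj:
  assumes f: "antimono f" and fits: "ribbon_fits f K h i" "ribbon_fits f K h' i'"
    and eq: "add_ribbon f K h i = add_ribbon f K h' i'"
  shows "h = h' \<and> i = i'"
proof -
  have "h \<le> l \<and> l \<le> i \<longleftrightarrow> h' \<le> l \<and> l \<le> i'" for l
    using add_ribbon_greater_iff[OF f fits(1), of l] add_ribbon_greater_iff[OF f fits(2), of l] eq by simp
  from this[of h] this[of h'] this[of i] this[of i'] show ?thesis
    using fits by (auto simp: ribbon_fits_def)
qed

text \<open>The raised bead lies strictly between its new neighbours, so its new rank
  \<open>h\<close> is determined.\<close>

lemma ribbon_fits_unique:
  assumes f: "antimono f" and fits: "ribbon_fits f K h i" "ribbon_fits f K h' i"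
  shows "h = h'"
proof -
  have "\<not> h < h'" if "ribbon_fits f K h i" "ribbon_fits f K h' i" for h h'
  proof
    assume "h < h'"
    then have "f (h' - 1) \<le> f h" by (intro antimonoD[OF f]) simp
    then show False
      using that \<open>h < h'\<close> by (simp add: ribbon_fits_def)
  qed
  then show ?thesis using fits by (meson linorder_neqE_nat)
qed

section \<open>The determinant after one bead is moved\<close>

lemma row_det_add_ribbon:
  assumes fits: "ribbon_fits f K h i" and i: "i < m"
  shows "row_det m F (bead m (add_ribbon f K h i)) =
    (- 1) ^ (i - h) * row_det m F ((bead m f)(i := bead m f i + K))"
proof -
  let ?c = "(bead m f)(i := bead m f i + K)"
  have hi: "h \<le> i" using fits by (simp add: ribbon_fits_def)
  have "row_det m F (bead m (add_ribbon f K h i)) =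
    row_det m F (\<lambda>l. if l = h then ?c i else if h < l \<and> l \<le> i then ?c (l - 1) else ?c l)"
    using fits i by (intro row_det_cong) (auto simp: bead_def add_ribbon_def ribbon_fits_def)
  also have "\<dots> = (- 1) ^ (i - h) * row_det m F ?c"
    by (rule row_det_move_row[OF hi i])
  finally show ?thesis .
qed

text \<open>Let \<open>h\<close> be the first bead below the new position. Minimality puts bead
  \<open>h - 1\<close> at or above that position, and since \<open>h\<close> does not fit, it is
  exactly there: two rows coincide.\<close>

lemma row_det_move_bead_eq_0:
  assumes i: "i < m" and K: "K \<ge> 1" and no_fit: "\<And>h. \<not> ribbon_fits f K h i"
  shows "row_det m F ((bead m f)(i := bead m f i + K)) = 0"
proof -
  define h where "h = (LEAST h. f h + i < f i + K + h)"
  have h: "f h + i < f i + K + h"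
    unfolding h_def by (rule LeastI[of _ i]) (use K in simp)
  have hi: "h \<le> i"
    unfolding h_def by (rule Least_le) (use K in simp)
  have h0: "h \<noteq> 0" using no_fit[of h] h hi by (auto simp: ribbon_fits_def)
  then have "\<not> f (h - 1) + i < f i + K + (h - 1)"
    using not_less_Least[of "h - 1" "\<lambda>h. f h + i < f i + K + h"] by (simp add: h_def)
  then have "f (h - 1) + i + 1 = f i + K + h"
    using no_fit[of h] h hi h0 by (auto simp: ribbon_fits_def)
  then have "bead m f (h - 1) = bead m f i + K"
    using hi h0 i by (simp add: bead_def)
  then show ?thesis
    using hi h0 i by (intro row_det_eq_0[of i m "h - 1"]) auto
qed

text \<open>Extensions correspond to the shapes in \<open>G\<close>, these to the pairs in
  \<open>P\<close>, and these to the moved bead \<open>i\<close> alone. Beads that fit nowhere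
  contribute zero.\<close>

lemma sum_row_det_move_bead:
  assumes lam: "is_partition lam" "length lam \<le> m" and K: "K \<ge> 1"
  shows "(\<Sum>i<m. row_det m F ((bead m (parts lam))(i := bead m (parts lam) i + K))) =
    (\<Sum>mu\<in>ribbon_extensions m lam K.
       (- 1) ^ ribbon_height (skew_diagram mu lam) * row_det m F (bead m (parts mu)))"
proof -
  define f where "f = parts lam"
  define P where "P = {(h, i). i < m \<and> ribbon_fits f K h i}"
  define G where "G = {g. antimono g \<and> (\<forall>i\<ge>m. g i = 0) \<and> f \<le> g \<and>
    is_ribbon (shape_boxes g - shape_boxes f) \<and> card (shape_boxes g - shape_boxes f) = K}"
  let ?c = "\<lambda>i. (bead m f)(i := bead m f i + K)"
  let ?ht = "\<lambda>g. ribbon_height (shape_boxes g - shape_boxes f)"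
  have f: "antimono f" unfolding f_def by (rule antimono_parts[OF lam(1)])
  have f0: "f i = 0" if "m \<le> i" for i using that lam(2) by (simp add: f_def parts_def)
  have G: "G = (\<lambda>(h, i). add_ribbon f K h i) ` P"
  proof (intro equalityI subsetI)
    fix g assume "g \<in> G"
    then obtain h i where "i < m" "ribbon_fits f K h i" "g = add_ribbon f K h i"
      using ribbon_eq_add_ribbon[OF f, of g m K] K by (auto simp: G_def)
    then show "g \<in> (\<lambda>(h, i). add_ribbon f K h i) ` P" by (force simp: P_def)
  next
    fix g assume "g \<in> (\<lambda>(h, i). add_ribbon f K h i) ` P"
    then obtain h i where hi: "i < m" and fits: "ribbon_fits f K h i" and g: "g = add_ribbon f K h i"
      by (auto simp: P_def)
    have "g l = 0" if "m \<le> l" for l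
      using that hi fits f0 add_ribbon_outside[of h l i f K] by (simp add: g ribbon_fits_def)
    then show "g \<in> G"
      using antimono_add_ribbon[OF f fits] le_add_ribbon[OF f fits] is_ribbon_add_ribbon[OF f fits]
        card_add_ribbon[OF f fits] by (simp add: G_def g)
  qed
  have "parts ` ribbon_extensions m lam K = G"
  proof (intro equalityI subsetI)
    fix g assume "g \<in> parts ` ribbon_extensions m lam K"
    then show "g \<in> G"
      by (auto simp: ribbon_extensions_def G_def antimono_parts skew_diagram_def f_def
          young_diagram_eq_shape_boxes shape_boxes_subset_iff) (simp add: parts_def)
  next
    fix g assume g: "g \<in> G"
    then obtain mu where "is_partition mu" "length mu \<le> m" "parts mu = g"
      using obtain_partition_of_shape[of g m] by (auto simp: G_def)
    then show "g \<in> parts ` ribbon_extensions m lam K"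
      using g by (auto simp: ribbon_extensions_def G_def skew_diagram_def f_def
          young_diagram_eq_shape_boxes shape_boxes_subset_iff)
  qed
  moreover have "inj_on parts (ribbon_extensions m lam K)"
    by (rule inj_on_subset[OF inj_on_parts]) (auto simp: ribbon_extensions_def)
  ultimately have "(\<Sum>mu\<in>ribbon_extensions m lam K.
       (- 1) ^ ribbon_height (skew_diagram mu lam) * row_det m F (bead m (parts mu))) =
      (\<Sum>g\<in>G. (- 1) ^ ?ht g * row_det m F (bead m g))"
    by (auto simp: sum.reindex skew_diagram_def f_def young_diagram_eq_shape_boxes)
  also have "\<dots> = (\<Sum>(h, i)\<in>P. (- 1) ^ ?ht (add_ribbon f K h i) * row_det m F (bead m (add_ribbon f K h i)))"
  proof -
    have "inj_on (\<lambda>(h, i). add_ribbon f K h i) P"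
      by (auto simp: inj_on_def P_def dest: add_ribbon_inj[OF f])
    then show ?thesis unfolding G by (simp add: sum.reindex case_prod_unfold)
  qed
  \<comment> \<open>The sign of the height and the sign from sorting the beads are both
    \<open>(- 1) ^ (i - h)\<close> and cancel.\<close>
  also have "\<dots> = (\<Sum>(h, i)\<in>P. row_det m F (?c i))"
    by (intro sum.cong refl)
      (auto simp: P_def ribbon_height_add_ribbon[OF f] row_det_add_ribbon
        simp flip: mult.assoc power_add mult_2)
  also have "\<dots> = (\<Sum>i\<in>snd ` P. row_det m F (?c i))"
  proof -
    have "inj_on snd P"
      by (auto simp: inj_on_def P_def dest: ribbon_fits_unique[OF f])
    then show ?thesis by (simp add: sum.reindex case_prod_unfold)
  qed
  also have "\<dots> = (\<Sum>i<m. row_det m F (?c i))"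
  proof (rule sum.mono_neutral_left)
    show "\<forall>i\<in>{..<m} - snd ` P. row_det m F (?c i) = 0"
    proof
      fix i assume i: "i \<in> {..<m} - snd ` P"
      then have "\<not> ribbon_fits f K h i" for h by (force simp: P_def)
      then show "row_det m F (?c i) = 0"
        using i K by (intro row_det_move_bead_eq_0) auto
    qed
  qed (auto simp: P_def)
  finally show ?thesis by (simp add: f_def)
qed

section \<open>Loop Schur functions\<close>

lemma tableau_sum_cong:
  assumes "\<And>a b. b \<in> D \<Longrightarrow> x a b = x' a b"
  shows "tableau_sum x a D = tableau_sum x' a D"
  using assms by (simp add: tableau_sum_def)

text \<open>The step to \<open>p\<close> has superscript \<open>r + m - p\<close>, which for the box
  at \<open>p = j + m - i\<close> is \<open>r + i - j\<close>. Having at most \<open>m\<close> rows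
  keeps the subtraction of naturals exact.\<close>

lemma loop_schur_eq_row_det:
  assumes "is_partition lam" "length lam \<le> m"
  shows "loop_schur n a r lam =
    row_det m (basis_seq (\<lambda>i p. loop_var n i (r + int m - int p)) m a) (bead m (parts lam))"
proof -
  have "loop_schur n a r lam =
      tableau_sum (\<lambda>a (i, j). loop_var n a (r + int i - int j)) a (young_diagram lam)"
    by (simp add: loop_schur_def tableau_sum_def ssyt_def semistandard_def tableaux_def case_prod_unfold)
  also have "\<dots> = tableau_sum (\<lambda>a (i, j). loop_var n a (r + int m - int (j + m - i))) a (young_diagram lam)"
    using assms(2) by (intro tableau_sum_cong) (auto simp: young_diagram_def of_nat_diff algebra_simps)
  also have "\<dots> = row_det m (basis_seq (\<lambda>i p. loop_var n i (r + int m - int p)) m a) (bead m (parts lam))"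
    unfolding young_diagram_eq_shape_boxes
    by (rule tableau_sum_eq_row_det[OF antimono_parts[OF assms(1)]])
       (use assms(2) in \<open>simp add: parts_def\<close>)
  finally show ?thesis .
qed

section \<open>Products of variables over full periods\<close>

lemma loop_var_cong: "j mod int n = j' mod int n \<Longrightarrow> loop_var n i j = loop_var n i j'"
  by (simp add: loop_var_def)

text \<open>Bead steps run through the superscripts downwards (\<open>e = - 1\<close>),
  \<open>loop_pi\<close> upwards (\<open>e = 1\<close>).\<close>

lemma bij_betw_residues:
  fixes s e :: int
  assumes n: "n \<ge> 1" and e: "e = 1 \<or> e = - 1"
  shows "bij_betw (\<lambda>p. (s + e * int p) mod int n) {0<..n} {0..<int n}"
proof -
  have inj: "inj_on (\<lambda>p. (s + e * int p) mod int n) {0<..n}"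
  proof (rule inj_onI)
    fix p q assume pq: "p \<in> {0<..n}" "q \<in> {0<..n}" and
      "(s + e * int p) mod int n = (s + e * int q) mod int n"
    then have "int n dvd e * (int p - int q)"
      by (simp add: mod_eq_dvd_iff algebra_simps)
    then have "int n dvd int p - int q"
      using e by (auto simp: dvd_diff_commute)
    moreover have "\<bar>int p - int q\<bar> < int n" using pq by auto
    ultimately show "p = q"
      by (metis abs_ge_zero dvd_imp_le_int eq_iff_diff_eq_0 not_less abs_of_nat of_nat_eq_iff)
  qed
  have "(\<lambda>p. (s + e * int p) mod int n) ` {0<..n} = {0..<int n}"
  proof (rule card_subset_eq)
    show "(\<lambda>p. (s + e * int p) mod int n) ` {0<..n} \<subseteq> {0..<int n}"
      using n by auto
    show "card ((\<lambda>p. (s + e * int p) mod int n) ` {0<..n}) = card {0..<int n}"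
      by (simp add: card_image[OF inj])
  qed simp
  with inj show ?thesis by (simp add: bij_betw_def)
qed

lemma prod_loop_var_period:
  fixes s e :: int
  assumes n: "n \<ge> 1" and e: "e = 1 \<or> e = - 1"
  shows "(\<Prod>p\<in>{0<..n}. loop_var n i (s + e * int p)) = (\<Prod>q\<in>{0..<int n}. loop_var n i q)"
proof -
  have "(\<Prod>q\<in>{0..<int n}. loop_var n i q) =
      (\<Prod>p\<in>{0<..n}. loop_var n i ((s + e * int p) mod int n))"
    by (rule prod.reindex_bij_betw[OF bij_betw_residues[OF assms], symmetric])
  also have "\<dots> = (\<Prod>p\<in>{0<..n}. loop_var n i (s + e * int p))"
    by (intro prod.cong refl loop_var_cong) simp
  finally show ?thesis ..
qed

text \<open>The positions split into \<open>k\<close> blocks of length \<open>n\<close>. Each block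
  meets every residue once, so the offset \<open>s\<close> disappears.\<close>

lemma prod_loop_var_eq_loop_pi_power:
  assumes n: "n \<ge> 1"
  shows "(\<Prod>p\<in>{0<..k * n}. loop_var n i (s - int p)) = loop_pi n i ^ k"
proof (induction k)
  case (Suc k)
  have "{0<..Suc k * n} = {0<..k * n} \<union> {k * n<..k * n + n}" by auto
  then have "(\<Prod>p\<in>{0<..Suc k * n}. loop_var n i (s - int p)) =
      (\<Prod>p\<in>{0<..k * n} \<union> {k * n<..k * n + n}. loop_var n i (s - int p))"
    by simp
  also have "\<dots> = loop_pi n i ^ k * (\<Prod>p\<in>{k * n<..k * n + n}. loop_var n i (s - int p))"
    unfolding Suc[symmetric] by (rule prod.union_disjoint) auto
  also have "(\<Prod>p\<in>{k * n<..k * n + n}. loop_var n i (s - int p)) =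
      (\<Prod>p\<in>{0<..n}. loop_var n i ((s - int (k * n)) + (- 1) * int p))"
    by (rule prod.reindex_bij_witness[where i = "\<lambda>p. p + k * n" and j = "\<lambda>p. p - k * n"])
       (auto simp: of_nat_diff)
  also have "\<dots> = (\<Prod>p\<in>{0<..n}. loop_var n i (0 + 1 * int p))"
    using prod_loop_var_period[OF n, of "- 1" i "s - int (k * n)"] prod_loop_var_period[OF n, of 1 i 0]
    by simp
  also have "\<dots> = loop_pi n i"
    by (simp add: loop_pi_def atLeastSucAtMost_greaterThanAtMost)
  finally show ?case by (simp add: mult.commute)
qed simp

theorem theorem4p1:
  fixes m n k :: nat and r :: int and lam :: "nat list"
  assumes "m \<ge> 1" and "n \<ge> 1" and "k \<ge> 1"
    and "is_partition lam" and "length lam \<le> m"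
  shows "loop_power_sum n m k * loop_schur n m r lam =
    (\<Sum>mu \<in> ribbon_extensions m lam (k * n).
        (- 1) ^ ribbon_height (skew_diagram mu lam) * loop_schur n m r mu)"
proof -
  define y where "y = (\<lambda>i p. loop_var n i (r + int m - int p))"
  define c where "c = bead m (parts lam)"
  let ?F = "basis_seq y m m" and ?K = "k * n"
  have K: "?K \<ge> 1" using assms by (simp add: Suc_le_eq)
  have "y i (p + ?K) = y i p" for i p
    unfolding y_def by (rule loop_var_cong) (simp add: mod_eq_dvd_iff)
  \<comment> \<open>All \<open>m\<close> variables are applied to \<open>m\<close> sequences: this
    is the last level that \<open>shift_basis_seq_trace\<close> reaches, and its trace runs over
    every variable.\<close>
  then obtain T where T: "\<And>j c. j < m \<Longrightarrow> ?F j (c + ?K) = (\<Sum>l<m. T j l * ?F l c)"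
    and tr: "(\<Sum>j<m. T j j) = (\<Sum>i = 1..m. \<Prod>p\<in>{0<..?K}. y i p)"
    using shift_basis_seq_trace[of y ?K m m] K by auto
  have "loop_power_sum n m k = (\<Sum>j<m. T j j)"
    by (simp add: tr loop_power_sum_def y_def prod_loop_var_eq_loop_pi_power[OF assms(2)])
  then have "loop_power_sum n m k * loop_schur n m r lam = (\<Sum>j<m. T j j) * row_det m ?F c"
    using assms by (simp add: loop_schur_eq_row_det y_def c_def)
  also have "\<dots> = (\<Sum>i<m. row_det m ?F (c(i := c i + ?K)))"
    by (rule sum_row_det_eq_trace[symmetric]) (rule T)
  also have "\<dots> = (\<Sum>mu\<in>ribbon_extensions m lam ?K.
      (- 1) ^ ribbon_height (skew_diagram mu lam) * row_det m ?F (bead m (parts mu)))"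
    unfolding c_def by (rule sum_row_det_move_bead[OF assms(4,5) K])
  also have "\<dots> = (\<Sum>mu\<in>ribbon_extensions m lam ?K.
      (- 1) ^ ribbon_height (skew_diagram mu lam) * loop_schur n m r mu)"
    by (intro sum.cong refl) (simp add: ribbon_extensions_def loop_schur_eq_row_det[of _ m] y_def)
  finally show ?thesis .
qed

end
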